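(* The cohomology of $d$ in form degree strictly less than $D$ is trivial in the space of invariant polynomials with strictly positive antighost number. That is, if $\alpha=\alpha([\chi^{*\Delta}],[F])$ is an invariant polynomial with $$\gamma\alpha=0,\qquad d\alpha=0,\qquad \mathrm{agh}(\alpha)>0,\qquad \deg\alpha<D,$$ then $\alpha=d\beta$ for some invariant polynomial $\beta([\chi^{*\Delta}],[F])$.
   Context: Conventions. Fix $D\ge 5$ and flat $\mathbb{R}^D$ with Minkowski metric $\sigma=\mathrm{diag}(-,+,\dots,+)$. $[\mu\nu\cdots]$ on indices denotes antisymmetrization without normalization factors and with the minimal number of terms, e.g. $\partial_{[\mu}C_{\nu]\alpha}=\partial_\mu C_{\nu\alpha}-\partial_\nu C_{\mu\alpha}$, $t_{[\mu\nu|\alpha]\beta}=t_{\mu\nu|\alpha\beta}+t_{\nu\alpha|\mu\beta}+t_{\alpha\mu|\nu\beta}$. The notation $f([q])$ means that $f$ depends on $q$ and finitely many of its derivatives. Generators. The field $t_{\mu\nu|\alpha\beta}$ (commuting) is antisymmetric in $\mu\nu$ and in $\alpha\beta$, symmetric under exchange of the two pairs, and $t_{[\mu\nu|\alpha]\beta}=0$. Ghosts: $\eta_{\mu\nu|\alpha}$ (anticommuting), antisymmetric in $\mu\nu$ with $\eta_{[\mu\nu|\alpha]}=0$; $C_{\mu\nu}=-C_{\nu\mu}$ (commuting). Antifields $\chi^{*\Delta}=(t^{*\mu\nu|\alpha\beta},\eta^{*\mu\nu|\alpha},C^{*\mu\nu})$ have the same index symmetries as $t,\eta,C$ respectively and opposite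 Grassmann parity (odd, even, odd). Apart from these symmetries, all components and all their derivatives (symmetric in derivative indices) are independent jet variables. Local forms are polynomials with constant coefficients in these variables and the $dx^\mu$ (no explicit $x$-dependence). $d=dx^\mu\partial_\mu$ with $\partial_\mu$ the total derivative; $\deg$ is the form degree. Antighost number agh: $t,\eta,C:0$; $t^*:1$, $\eta^*:2$, $C^*:3$; derivatives and $dx^\mu$ do not change it. Differential. $\gamma$ is the nilpotent (right) derivation commuting with $\partial_\mu$ given by $\gamma t_{\mu\nu|\alpha\beta}=\partial_\mu\eta_{\alpha\beta|\nu}-\partial_\nu\eta_{\alpha\beta|\mu}+\partial_\alpha\eta_{\mu\nu|\beta}-\partial_\beta\eta_{\mu\nu|\alpha}$, $\gamma\eta_{\mu\nu|\alpha}=2\partial_\alpha C_{\mu\nu}-\partial_{[\mu}C_{\nu]\alpha}$, $\gamma C_{\mu\nu}=0$, $\gamma\chi^{*\Delta}=0$. Invariant polynomials. The curvature $F$ has components $F_{\mu\nu\lambda|\alpha\beta\gamma}=\partial_\lambda\partial_\gamma t_{\mu\nu|\alpha\beta}+$ the eight further terms obtained by cyclic permutations of $(\mu,\nu,\lambda)$ and, independently, of $(\alpha,\beta,\gamma)$. An invariant polynomial is a local form that is a polynomial in the antifields $\chi^{*\Delta}$, the components of $F$, and their derivatives (and the $dx^\mu$). *)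

theory Defs
  imports Complex_Main "HOL-Library.Multiset" "HOL-Library.Cardinality"
begin

section \<open>Jet variables\<close>

text \<open>Spacetime indices range over a finite type \<open>'d\<close>, so the dimension is \<open>CARD('d)\<close>.
  Components are named by the column lengths of the Young symmetry:
  \<open>Col22\<close> for $t$, $t^*$; \<open>Col21\<close> for $\eta$, $\eta^*$; \<open>Col2\<close> for $C$, $C^*$.
  The bars separate as $t_{\mu\nu|\alpha\beta}$, $\eta_{\mu\nu|\alpha}$.\<close>

datatype 'd component = Col22 'd 'd 'd 'd | Col21 'd 'd 'd | Col2 'd 'd

datatype sector = Field | Antifield

text \<open>The multiset holds the (symmetric) derivative indices of a jet variable.\<close>

datatype 'd generator = Jet sector "'d multiset" "'d component" | Dx 'd

fun odd_component :: "'d component \<Rightarrow> bool" where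
  "odd_component (Col22 _ _ _ _) = False"
| "odd_component (Col21 _ _ _) = True"
| "odd_component (Col2 _ _) = False"

fun odd_gen :: "'d generator \<Rightarrow> bool" where
  "odd_gen (Jet Field M c) = odd_component c"
| "odd_gen (Jet Antifield M c) = (\<not> odd_component c)"
| "odd_gen (Dx \<mu>) = True"

fun agh :: "'d generator \<Rightarrow> nat" where
  "agh (Jet Antifield M (Col22 _ _ _ _)) = 1"
| "agh (Jet Antifield M (Col21 _ _ _)) = 2"
| "agh (Jet Antifield M (Col2 _ _)) = 3"
| "agh (Jet Field M c) = 0"
| "agh (Dx \<mu>) = 0"

fun form_deg :: "'d generator \<Rightarrow> nat" where
  "form_deg (Jet k M c) = 0"
| "form_deg (Dx \<mu>) = 1"


section \<open>The algebra of local forms\<close>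

text \<open>Local forms with constant coefficients are the real unital associative algebra presented by
  the generators above, subject to graded commutativity and to the index symmetries of the
  components. The form generators \<open>Dx \<mu>\<close> count as Grassmann odd, so they also anticommute with
  the odd jet variables.\<close>

datatype 'd expr =
    Const real
  | Gen "'d generator"
  | Add "'d expr" "'d expr"
  | Mult "'d expr" "'d expr"

inductive form_eq :: "'d expr \<Rightarrow> 'd expr \<Rightarrow> bool" (infix \<open>\<approx>\<close> 50) where
  refl: "a \<approx> a"
| sym: "a \<approx> b \<Longrightarrow> b \<approx> a"
| trans: "a \<approx> b \<Longrightarrow> b \<approx> c \<Longrightarrow> a \<approx> c"
| add_cong: "a \<approx> a' \<Longrightarrow> b \<approx> b' \<Longrightarrow> Add a b \<approx> Add a' b'"
| mult_cong: "a \<approx> a' \<Longrightarrow> b \<approx> b' \<Longrightarrow> Mult a b \<approx> Mult a' b'"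
  \<comment> \<open>real unital associative algebra\<close>
| add_assoc: "Add (Add a b) c \<approx> Add a (Add b c)"
| add_comm: "Add a b \<approx> Add b a"
| add_0: "Add (Const 0) a \<approx> a"
| mult_assoc: "Mult (Mult a b) c \<approx> Mult a (Mult b c)"
| distrib_left: "Mult a (Add b c) \<approx> Add (Mult a b) (Mult a c)"
| distrib_right: "Mult (Add a b) c \<approx> Add (Mult a c) (Mult b c)"
| mult_0: "Mult (Const 0) a \<approx> Const 0"
| mult_1: "Mult (Const 1) a \<approx> a"
| const_add: "Const (r + s) \<approx> Add (Const r) (Const s)"
| const_mult: "Const (r * s) \<approx> Mult (Const r) (Const s)"
| const_central: "Mult a (Const r) \<approx> Mult (Const r) a"
  \<comment> \<open>graded commutativity\<close>
| graded_comm: "Mult (Gen g) (Gen h) \<approx>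
    Mult (Const (if odd_gen g \<and> odd_gen h then - 1 else 1)) (Mult (Gen h) (Gen g))"
  \<comment> \<open>index symmetries; the same for fields and antifields\<close>
| sym22_1: "Gen (Jet k M (Col22 \<nu> \<mu> \<alpha> \<beta>)) \<approx> Mult (Const (- 1)) (Gen (Jet k M (Col22 \<mu> \<nu> \<alpha> \<beta>)))"
| sym22_2: "Gen (Jet k M (Col22 \<mu> \<nu> \<beta> \<alpha>)) \<approx> Mult (Const (- 1)) (Gen (Jet k M (Col22 \<mu> \<nu> \<alpha> \<beta>)))"
| sym22_3: "Gen (Jet k M (Col22 \<alpha> \<beta> \<mu> \<nu>)) \<approx> Gen (Jet k M (Col22 \<mu> \<nu> \<alpha> \<beta>))"
| cyc22: "Add (Gen (Jet k M (Col22 \<mu> \<nu> \<alpha> \<beta>)))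
    (Add (Gen (Jet k M (Col22 \<nu> \<alpha> \<mu> \<beta>))) (Gen (Jet k M (Col22 \<alpha> \<mu> \<nu> \<beta>)))) \<approx> Const 0"
| sym21: "Gen (Jet k M (Col21 \<nu> \<mu> \<alpha>)) \<approx> Mult (Const (- 1)) (Gen (Jet k M (Col21 \<mu> \<nu> \<alpha>)))"
| cyc21: "Add (Gen (Jet k M (Col21 \<mu> \<nu> \<alpha>)))
    (Add (Gen (Jet k M (Col21 \<nu> \<alpha> \<mu>))) (Gen (Jet k M (Col21 \<alpha> \<mu> \<nu>)))) \<approx> Const 0"
| sym2: "Gen (Jet k M (Col2 \<nu> \<mu>)) \<approx> Mult (Const (- 1)) (Gen (Jet k M (Col2 \<mu> \<nu>)))"

quotient_type 'd local_form = "'d expr" / form_eq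
  by (intro equivpI reflpI sympI transpI) (blast intro: form_eq.intros)+

lift_definition gen :: "'d generator \<Rightarrow> 'd local_form" is Gen .

text \<open>Evaluation at the origin; used only to see that the algebra is not the zero ring.\<close>

primrec expr_eval0 :: "'d expr \<Rightarrow> real" where
  "expr_eval0 (Const r) = r"
| "expr_eval0 (Gen g) = 0"
| "expr_eval0 (Add a b) = expr_eval0 a + expr_eval0 b"
| "expr_eval0 (Mult a b) = expr_eval0 a * expr_eval0 b"

lemma expr_eval0_cong: "a \<approx> b \<Longrightarrow> expr_eval0 a = expr_eval0 b"
  by (induction rule: form_eq.induct) (auto simp: algebra_simps)

lemma add_inverse_expr: "Add (Mult (Const (- 1)) a) a \<approx> Const 0"
proof -
  note [trans] = form_eq.trans
  have "Add (Mult (Const (- 1)) a) a \<approx> Add (Mult (Const (- 1)) a) (Mult (Const 1) a)"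
    by (blast intro: form_eq.intros)
  also have "\<dots> \<approx> Mult (Add (Const (- 1)) (Const 1)) a"
    by (blast intro: form_eq.intros)
  also have "\<dots> \<approx> Mult (Const (- 1 + 1)) a"
    by (blast intro: form_eq.intros)
  also have "\<dots> \<approx> Const 0"
    by (simp add: form_eq.mult_0)
  finally show ?thesis .
qed

instantiation local_form :: (type) real_algebra_1
begin

lift_definition zero_local_form :: "'a local_form" is "Const 0" .
lift_definition one_local_form :: "'a local_form" is "Const 1" .
lift_definition plus_local_form :: "'a local_form \<Rightarrow> 'a local_form \<Rightarrow> 'a local_form" is Add
  by (rule form_eq.add_cong)
lift_definition times_local_form :: "'a local_form \<Rightarrow> 'a local_form \<Rightarrow> 'a local_form" is Mult
  by (rule form_eq.mult_cong)
lift_definition scaleR_local_form :: "real \<Rightarrow> 'a local_form \<Rightarrow> 'a local_form"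
  is "\<lambda>r. Mult (Const r)"
  by (rule form_eq.mult_cong[OF form_eq.refl])
lift_definition uminus_local_form :: "'a local_form \<Rightarrow> 'a local_form" is "Mult (Const (- 1))"
  by (rule form_eq.mult_cong[OF form_eq.refl])
definition minus_local_form :: "'a local_form \<Rightarrow> 'a local_form \<Rightarrow> 'a local_form" where
  "minus_local_form a b = a + - b"

instance
proof
  fix a b c :: "'a local_form" and r s :: real
  show "a + b + c = a + (b + c)" by transfer (rule form_eq.add_assoc)
  show "a + b = b + a" by transfer (rule form_eq.add_comm)
  show "0 + a = a" by transfer (rule form_eq.add_0)
  show "- a + a = 0" by transfer (rule add_inverse_expr)
  show "a - b = a + - b" by (rule minus_local_form_def)
  show "a * b * c = a * (b * c)" by transfer (rule form_eq.mult_assoc)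
  show "(a + b) * c = a * c + b * c" by transfer (rule form_eq.distrib_right)
  show "a * (b + c) = a * b + a * c" by transfer (rule form_eq.distrib_left)
  show "1 * a = a" by transfer (rule form_eq.mult_1)
  show "a * 1 = a"
    by transfer (rule form_eq.trans[OF form_eq.const_central form_eq.mult_1])
  show "(0::'a local_form) \<noteq> 1" by transfer (use expr_eval0_cong in fastforce)
  show "r *\<^sub>R (a + b) = r *\<^sub>R a + r *\<^sub>R b" by transfer (rule form_eq.distrib_left)
  show "(r + s) *\<^sub>R a = r *\<^sub>R a + s *\<^sub>R a"
    by transfer (rule form_eq.trans[OF form_eq.mult_cong[OF form_eq.const_add form_eq.refl]
          form_eq.distrib_right])
  show "r *\<^sub>R s *\<^sub>R a = (r * s) *\<^sub>R a"
    by transfer (rule form_eq.sym[OF form_eq.trans[OF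
            form_eq.mult_cong[OF form_eq.const_mult form_eq.refl] form_eq.mult_assoc]])
  show "1 *\<^sub>R a = a" by transfer (rule form_eq.mult_1)
  show "r *\<^sub>R a * b = r *\<^sub>R (a * b)" by transfer (rule form_eq.mult_assoc)
  show "a * r *\<^sub>R b = r *\<^sub>R (a * b)"
    by transfer (rule form_eq.trans[OF form_eq.sym[OF form_eq.mult_assoc]
          form_eq.trans[OF form_eq.mult_cong[OF form_eq.const_central form_eq.refl]
            form_eq.mult_assoc]])
qed

end

lemma abs_Const: "abs_local_form (Const r) = of_real r"
  unfolding of_real_def
  by transfer (rule form_eq.sym[OF form_eq.trans[OF form_eq.const_central form_eq.mult_1]])

lemma abs_Gen: "abs_local_form (Gen g) = gen g"
  by (simp add: gen.abs_eq)

lemma abs_Add: "abs_local_form (Add a b) = abs_local_form a + abs_local_form b"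
  by (simp add: plus_local_form.abs_eq)

lemma abs_Mult: "abs_local_form (Mult a b) = abs_local_form a * abs_local_form b"
  by (simp add: times_local_form.abs_eq)

lemmas abs_simps = abs_Const abs_Gen abs_Add abs_Mult

lemma abs_eqI: "a \<approx> b \<Longrightarrow> abs_local_form a = abs_local_form b"
  by (simp add: local_form.abs_eq_iff)

lemma local_form_induct [case_names const gen add mult, induct type: local_form]:
  assumes "\<And>r. P (of_real r)" and "\<And>g. P (gen g)"
    and "\<And>a b. P a \<Longrightarrow> P b \<Longrightarrow> P (a + b)" and "\<And>a b. P a \<Longrightarrow> P b \<Longrightarrow> P (a * b)"
  shows "P x"
proof (induction x rule: local_form.abs_induct)
  fix y show "P (abs_local_form y)"
    by (induction y) (simp_all add: abs_simps assms)
qed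

abbreviation jet :: "sector \<Rightarrow> 'd multiset \<Rightarrow> 'd component \<Rightarrow> 'd local_form" where
  "jet k M c \<equiv> gen (Jet k M c)"

abbreviation dx :: "'d \<Rightarrow> 'd local_form" where
  "dx \<mu> \<equiv> gen (Dx \<mu>)"

lemma gen_comm: "gen g * gen h = (if odd_gen g \<and> odd_gen h then - (gen h * gen g) else gen h * gen g)"
  using abs_eqI[OF form_eq.graded_comm[of g h]] by (simp add: abs_simps split: if_splits)

lemma jet_sym22_1: "jet k M (Col22 \<nu> \<mu> \<alpha> \<beta>) = - jet k M (Col22 \<mu> \<nu> \<alpha> \<beta>)"
  by (rule abs_eqI[OF form_eq.sym22_1, unfolded abs_simps, unfolded of_real_minus of_real_1 of_real_0 mult_minus_left mult_1_left])

lemma jet_sym22_2: "jet k M (Col22 \<mu> \<nu> \<beta> \<alpha>) = - jet k M (Col22 \<mu> \<nu> \<alpha> \<beta>)"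
  by (rule abs_eqI[OF form_eq.sym22_2, unfolded abs_simps, unfolded of_real_minus of_real_1 of_real_0 mult_minus_left mult_1_left])

lemma jet_sym22_3: "jet k M (Col22 \<alpha> \<beta> \<mu> \<nu>) = jet k M (Col22 \<mu> \<nu> \<alpha> \<beta>)"
  by (rule abs_eqI[OF form_eq.sym22_3, unfolded abs_simps, unfolded of_real_minus of_real_1 of_real_0 mult_minus_left mult_1_left])

lemma jet_cyc22: "jet k M (Col22 \<mu> \<nu> \<alpha> \<beta>) +
    (jet k M (Col22 \<nu> \<alpha> \<mu> \<beta>) + jet k M (Col22 \<alpha> \<mu> \<nu> \<beta>)) = 0"
  by (rule abs_eqI[OF form_eq.cyc22, unfolded abs_simps, unfolded of_real_minus of_real_1 of_real_0 mult_minus_left mult_1_left])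

lemma jet_sym21: "jet k M (Col21 \<nu> \<mu> \<alpha>) = - jet k M (Col21 \<mu> \<nu> \<alpha>)"
  by (rule abs_eqI[OF form_eq.sym21, unfolded abs_simps, unfolded of_real_minus of_real_1 of_real_0 mult_minus_left mult_1_left])

lemma jet_cyc21: "jet k M (Col21 \<mu> \<nu> \<alpha>) +
    (jet k M (Col21 \<nu> \<alpha> \<mu>) + jet k M (Col21 \<alpha> \<mu> \<nu>)) = 0"
  by (rule abs_eqI[OF form_eq.cyc21, unfolded abs_simps, unfolded of_real_minus of_real_1 of_real_0 mult_minus_left mult_1_left])

lemma jet_sym2: "jet k M (Col2 \<nu> \<mu>) = - jet k M (Col2 \<mu> \<nu>)"
  by (rule abs_eqI[OF form_eq.sym2, unfolded abs_simps, unfolded of_real_minus of_real_1 of_real_0 mult_minus_left mult_1_left])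


section \<open>Total derivative and exterior differential\<close>

fun total_deriv_gen :: "'d \<Rightarrow> 'd generator \<Rightarrow> 'd local_form" where
  "total_deriv_gen \<rho> (Jet k M c) = jet k (add_mset \<rho> M) c"
| "total_deriv_gen \<rho> (Dx \<mu>) = 0"

primrec total_deriv_expr :: "'d \<Rightarrow> 'd expr \<Rightarrow> 'd local_form" where
  "total_deriv_expr \<rho> (Const r) = 0"
| "total_deriv_expr \<rho> (Gen g) = total_deriv_gen \<rho> g"
| "total_deriv_expr \<rho> (Add a b) = total_deriv_expr \<rho> a + total_deriv_expr \<rho> b"
| "total_deriv_expr \<rho> (Mult a b) =
    total_deriv_expr \<rho> a * abs_local_form b + abs_local_form a * total_deriv_expr \<rho> b"

lemma total_deriv_gen_comm:
  "total_deriv_gen \<rho> g * gen h =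
    (if odd_gen g \<and> odd_gen h then - (gen h * total_deriv_gen \<rho> g) else gen h * total_deriv_gen \<rho> g)"
proof (cases g)
  case (Jet k M c)
  have "odd_gen (Jet k (add_mset \<rho> M) c) = odd_gen (Jet k M c)"
    by (cases k) auto
  then show ?thesis using Jet gen_comm[of "Jet k (add_mset \<rho> M) c" h] by simp
qed auto

lemma total_deriv_expr_cong: "a \<approx> b \<Longrightarrow> total_deriv_expr \<rho> a = total_deriv_expr \<rho> b"
proof (induction rule: form_eq.induct)
  case (graded_comm g h)
  then show ?case
    using total_deriv_gen_comm[of \<rho> g h] total_deriv_gen_comm[of \<rho> h g] gen_comm[of g h]
    by (auto simp: abs_simps algebra_simps split: if_splits)
next
  case (mult_cong a a' b b')
  then show ?case by (simp add: abs_eqI)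
next
  case (const_central a r)
  then show ?case by (simp add: abs_simps of_real_def)
qed (auto simp: abs_simps algebra_simps jet_cyc22 jet_cyc21
      intro: jet_sym22_1 jet_sym22_2 jet_sym22_3 jet_sym21 jet_sym2)

lift_definition total_deriv :: "'d \<Rightarrow> 'd local_form \<Rightarrow> 'd local_form" (\<open>\<partial>\<close>)
  is total_deriv_expr by (rule total_deriv_expr_cong)

lemma total_deriv_simps [simp]:
  "\<partial> \<rho> (of_real r) = 0"
  "\<partial> \<rho> (gen g) = total_deriv_gen \<rho> g"
  "\<partial> \<rho> (a + b) = \<partial> \<rho> a + \<partial> \<rho> b"
  "\<partial> \<rho> (a * b) = \<partial> \<rho> a * b + a * \<partial> \<rho> b"
proof -
  show "\<partial> \<rho> (of_real r) = 0"
    by (simp flip: abs_Const add: total_deriv.abs_eq)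
  show "\<partial> \<rho> (gen g) = total_deriv_gen \<rho> g"
    by (simp flip: abs_Gen add: total_deriv.abs_eq)
  show "\<partial> \<rho> (a + b) = \<partial> \<rho> a + \<partial> \<rho> b"
    by (induction a rule: local_form.abs_induct, induction b rule: local_form.abs_induct) (simp flip: abs_Add add: total_deriv.abs_eq)
  show "\<partial> \<rho> (a * b) = \<partial> \<rho> a * b + a * \<partial> \<rho> b"
    by (induction a rule: local_form.abs_induct, induction b rule: local_form.abs_induct) (simp flip: abs_Mult add: total_deriv.abs_eq)
qed

definition ext_d :: "'d::finite local_form \<Rightarrow> 'd local_form" where
  "ext_d a = (\<Sum>\<mu>\<in>UNIV. dx \<mu> * \<partial> \<mu> a)"


section \<open>The differential gamma\<close>

primrec grade_inv_expr :: "'d expr \<Rightarrow> 'd local_form" where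
  "grade_inv_expr (Const r) = of_real r"
| "grade_inv_expr (Gen g) = (if odd_gen g then - gen g else gen g)"
| "grade_inv_expr (Add a b) = grade_inv_expr a + grade_inv_expr b"
| "grade_inv_expr (Mult a b) = grade_inv_expr a * grade_inv_expr b"

lemma odd_gen_component:
  "odd_gen (Jet k M c) = (if k = Field then odd_component c else \<not> odd_component c)"
  by (cases k) auto

lemma neg_sum3: "- a + (- b + - c) = 0" if "a + (b + c) = 0" for a b c :: "'a::ab_group_add"
  using that by (metis minus_add_distrib minus_zero)

lemma grade_inv_expr_cong: "a \<approx> b \<Longrightarrow> grade_inv_expr a = grade_inv_expr b"
proof (induction rule: form_eq.induct)
  case (graded_comm g h)
  then show ?case using gen_comm[of g h] by auto
next
  case (const_central a r)
  then show ?case by (simp add: of_real_def)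
next
  case (cyc22 k M \<mu> \<nu> \<alpha> \<beta>)
  show ?case using jet_cyc22[of k M \<mu> \<nu> \<alpha> \<beta>] neg_sum3[OF jet_cyc22[of k M \<mu> \<nu> \<alpha> \<beta>]]
    by (cases k) (simp_all only: grade_inv_expr.simps odd_gen.simps odd_component.simps
        simp_thms if_True if_False of_real_0)
next
  case (cyc21 k M \<mu> \<nu> \<alpha>)
  show ?case using jet_cyc21[of k M \<mu> \<nu> \<alpha>] neg_sum3[OF jet_cyc21[of k M \<mu> \<nu> \<alpha>]]
    by (cases k) (simp_all only: grade_inv_expr.simps odd_gen.simps odd_component.simps
        simp_thms if_True if_False of_real_0)
qed (auto simp: algebra_simps odd_gen_component
      intro: jet_sym22_1 jet_sym22_2 jet_sym22_3 jet_sym21 jet_sym2)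

text \<open>The grading automorphism: multiplication by $(-1)^{\epsilon}$ on forms of Grassmann
  parity $\epsilon$ (the form generators included).\<close>

lift_definition grade_inv :: "'d local_form \<Rightarrow> 'd local_form" is grade_inv_expr
  by (rule grade_inv_expr_cong)

lemma grade_inv_simps [simp]:
  "grade_inv (of_real r) = of_real r"
  "grade_inv (gen g) = (if odd_gen g then - gen g else gen g)"
  "grade_inv (a + b) = grade_inv a + grade_inv b"
  "grade_inv (a * b) = grade_inv a * grade_inv b"
proof -
  show "grade_inv (of_real r) = of_real r"
    by (simp flip: abs_Const add: grade_inv.abs_eq)
  show "grade_inv (gen g) = (if odd_gen g then - gen g else gen g)"
    by (simp flip: abs_Gen add: grade_inv.abs_eq)
  show "grade_inv (a + b) = grade_inv a + grade_inv b"
    by (induction a rule: local_form.abs_induct, induction b rule: local_form.abs_induct) (simp flip: abs_Add add: grade_inv.abs_eq)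
  show "grade_inv (a * b) = grade_inv a * grade_inv b"
    by (induction a rule: local_form.abs_induct, induction b rule: local_form.abs_induct) (simp flip: abs_Mult add: grade_inv.abs_eq)
qed

text \<open>On a jet variable, \<open>\<gamma>\<close> is the corresponding derivative of its value on the undifferentiated
  component, so that it commutes with total derivatives.\<close>

fun gamma_gen :: "'d generator \<Rightarrow> 'd local_form" where
  "gamma_gen (Jet Field M (Col22 \<mu> \<nu> \<alpha> \<beta>)) =
     jet Field (add_mset \<mu> M) (Col21 \<alpha> \<beta> \<nu>) - jet Field (add_mset \<nu> M) (Col21 \<alpha> \<beta> \<mu>)
   + jet Field (add_mset \<alpha> M) (Col21 \<mu> \<nu> \<beta>) - jet Field (add_mset \<beta> M) (Col21 \<mu> \<nu> \<alpha>)"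
| "gamma_gen (Jet Field M (Col21 \<mu> \<nu> \<alpha>)) =
     2 *\<^sub>R jet Field (add_mset \<alpha> M) (Col2 \<mu> \<nu>)
   - (jet Field (add_mset \<mu> M) (Col2 \<nu> \<alpha>) - jet Field (add_mset \<nu> M) (Col2 \<mu> \<alpha>))"
| "gamma_gen (Jet Field M (Col2 \<mu> \<nu>)) = 0"
| "gamma_gen (Jet Antifield M c) = 0"
| "gamma_gen (Dx \<mu>) = 0"

text \<open>Right derivation: $\gamma(ab) = a\,\gamma b + (-1)^{\epsilon(b)} (\gamma a)\, b$.\<close>

primrec gamma_expr :: "'d expr \<Rightarrow> 'd local_form" where
  "gamma_expr (Const r) = 0"
| "gamma_expr (Gen g) = gamma_gen g"
| "gamma_expr (Add a b) = gamma_expr a + gamma_expr b"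
| "gamma_expr (Mult a b) =
    abs_local_form a * gamma_expr b + gamma_expr a * grade_inv (abs_local_form b)"

lemma gamma_gen_comm:
  "gen h * gamma_gen g =
    (if odd_gen h \<and> \<not> odd_gen g then - (gamma_gen g * gen h) else gamma_gen g * gen h)"
proof (cases g rule: gamma_gen.cases)
  case (1 M \<mu> \<nu> \<alpha> \<beta>)
  then show ?thesis
    using gen_comm[of h "Jet Field (add_mset \<mu> M) (Col21 \<alpha> \<beta> \<nu>)"]
      gen_comm[of h "Jet Field (add_mset \<nu> M) (Col21 \<alpha> \<beta> \<mu>)"]
      gen_comm[of h "Jet Field (add_mset \<alpha> M) (Col21 \<mu> \<nu> \<beta>)"]
      gen_comm[of h "Jet Field (add_mset \<beta> M) (Col21 \<mu> \<nu> \<alpha>)"]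
    by (simp add: algebra_simps split: if_splits)
next
  case (2 M \<mu> \<nu> \<alpha>)
  then show ?thesis
    using gen_comm[of h "Jet Field (add_mset \<alpha> M) (Col2 \<mu> \<nu>)"]
      gen_comm[of h "Jet Field (add_mset \<mu> M) (Col2 \<nu> \<alpha>)"]
      gen_comm[of h "Jet Field (add_mset \<nu> M) (Col2 \<mu> \<alpha>)"]
    by (simp add: algebra_simps split: if_splits)
qed auto

lemma gamma_gen_sym:
  "gamma_gen (Jet k M (Col22 \<nu> \<mu> \<alpha> \<beta>)) = - gamma_gen (Jet k M (Col22 \<mu> \<nu> \<alpha> \<beta>))"
  "gamma_gen (Jet k M (Col22 \<mu> \<nu> \<beta> \<alpha>)) = - gamma_gen (Jet k M (Col22 \<mu> \<nu> \<alpha> \<beta>))"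
  "gamma_gen (Jet k M (Col22 \<alpha> \<beta> \<mu> \<nu>)) = gamma_gen (Jet k M (Col22 \<mu> \<nu> \<alpha> \<beta>))"
  "gamma_gen (Jet k M (Col21 \<nu> \<mu> \<alpha>)) = - gamma_gen (Jet k M (Col21 \<mu> \<nu> \<alpha>))"
  "gamma_gen (Jet k M (Col2 \<nu> \<mu>)) = - gamma_gen (Jet k M (Col2 \<mu> \<nu>))"
  using jet_sym21[of Field _ \<nu> \<mu>] jet_sym21[of Field _ \<beta> \<alpha>] jet_sym2[of Field _ \<nu> \<mu>]
  by (cases k; simp)+

lemma gamma_gen_cyc22:
  "gamma_gen (Jet k M (Col22 \<mu> \<nu> \<alpha> \<beta>)) +
    (gamma_gen (Jet k M (Col22 \<nu> \<alpha> \<mu> \<beta>)) + gamma_gen (Jet k M (Col22 \<alpha> \<mu> \<nu> \<beta>))) = 0"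
proof (cases k)
  case Field
  let ?J = "\<lambda>\<rho> a b c. jet Field (add_mset \<rho> M) (Col21 a b c)"
  have key: "?J \<rho> a b c + ?J \<rho> c a b - ?J \<rho> c b a = 0" for \<rho> a b c
    using jet_cyc21[of Field "add_mset \<rho> M" a b c] jet_sym21[of Field "add_mset \<rho> M" b c a]
    by (simp add: algebra_simps)
  have "gamma_gen (Jet Field M (Col22 \<mu> \<nu> \<alpha> \<beta>)) +
      (gamma_gen (Jet Field M (Col22 \<nu> \<alpha> \<mu> \<beta>)) + gamma_gen (Jet Field M (Col22 \<alpha> \<mu> \<nu> \<beta>))) =
      (?J \<mu> \<alpha> \<beta> \<nu> + ?J \<mu> \<nu> \<alpha> \<beta> - ?J \<mu> \<nu> \<beta> \<alpha>)
    + (?J \<nu> \<mu> \<beta> \<alpha> + ?J \<nu> \<alpha> \<mu> \<beta> - ?J \<nu> \<alpha> \<beta> \<mu>)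
    + (?J \<alpha> \<nu> \<beta> \<mu> + ?J \<alpha> \<mu> \<nu> \<beta> - ?J \<alpha> \<mu> \<beta> \<nu>)
    - (?J \<beta> \<mu> \<nu> \<alpha> + (?J \<beta> \<nu> \<alpha> \<mu> + ?J \<beta> \<alpha> \<mu> \<nu>))"
    by (simp add: algebra_simps)
  then show ?thesis
    by (simp only: key jet_cyc21 Field) simp
qed auto

lemma gamma_gen_cyc21:
  "gamma_gen (Jet k M (Col21 \<mu> \<nu> \<alpha>)) +
    (gamma_gen (Jet k M (Col21 \<nu> \<alpha> \<mu>)) + gamma_gen (Jet k M (Col21 \<alpha> \<mu> \<nu>))) = 0"
proof (cases k)
  case Field
  let ?J = "\<lambda>\<rho> a b. jet Field (add_mset \<rho> M) (Col2 a b)"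
  have "?J \<rho> b a = - ?J \<rho> a b" for \<rho> a b
    by (rule jet_sym2)
  from this[of \<mu> \<nu> \<alpha>] this[of \<nu> \<mu> \<alpha>] this[of \<alpha> \<mu> \<nu>] show ?thesis
    by (simp add: Field algebra_simps scaleR_2)
qed auto

lemma gamma_expr_cong: "a \<approx> b \<Longrightarrow> gamma_expr a = gamma_expr b"
proof (induction rule: form_eq.induct)
  case (graded_comm g h)
  then show ?case
    using gamma_gen_comm[of g h] gamma_gen_comm[of h g]
    by (auto simp: abs_simps algebra_simps split: if_splits)
next
  case (mult_cong a a' b b')
  then show ?case by (simp add: abs_eqI)
next
  case (const_central a r)
  then show ?case by (simp add: abs_simps of_real_def flip: of_real_def)
      (simp add: of_real_def)
next
  case (mult_0 a)
  then show ?case by (simp add: abs_simps)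
qed (auto simp del: gamma_gen.simps
    simp: abs_simps algebra_simps gamma_gen_cyc22 gamma_gen_cyc21
    intro: gamma_gen_sym)

lift_definition gamma :: "'d local_form \<Rightarrow> 'd local_form" (\<open>\<gamma>\<close>) is gamma_expr
  by (rule gamma_expr_cong)

lemma gamma_simps [simp]:
  "\<gamma> (of_real r) = 0"
  "\<gamma> (gen g) = gamma_gen g"
  "\<gamma> (a + b) = \<gamma> a + \<gamma> b"
  "\<gamma> (a * b) = a * \<gamma> b + \<gamma> a * grade_inv b"
proof -
  show "\<gamma> (of_real r) = 0"
    by (simp flip: abs_Const add: gamma.abs_eq)
  show "\<gamma> (gen g) = gamma_gen g"
    by (simp flip: abs_Gen add: gamma.abs_eq)
  show "\<gamma> (a + b) = \<gamma> a + \<gamma> b"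
    by (induction a rule: local_form.abs_induct, induction b rule: local_form.abs_induct) (simp flip: abs_Add add: gamma.abs_eq)
  show "\<gamma> (a * b) = a * \<gamma> b + \<gamma> a * grade_inv b"
    by (induction a rule: local_form.abs_induct, induction b rule: local_form.abs_induct) (simp flip: abs_Mult add: gamma.abs_eq)
qed

lemma gamma_uminus [simp]: "\<gamma> (- a) = - \<gamma> a"
  using gamma_simps(3)[of a "- a"] gamma_simps(1)[of 0]
  by (metis add.right_inverse eq_neg_iff_add_eq_0 add.commute of_real_0)

lemma gamma_diff [simp]: "\<gamma> (a - b) = \<gamma> a - \<gamma> b"
  using gamma_simps(3)[of a "- b"] by simp

lemma grade_inv_uminus [simp]: "grade_inv (- a) = - grade_inv a"
  using grade_inv_simps(3)[of a "- a"] grade_inv_simps(1)[of 0]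
  by (metis add.right_inverse eq_neg_iff_add_eq_0 add.commute of_real_0)

lemma grade_inv_diff [simp]: "grade_inv (a - b) = grade_inv a - grade_inv b"
  using grade_inv_simps(3)[of a "- b"] by simp

lemma total_deriv_uminus [simp]: "\<partial> \<rho> (- a) = - \<partial> \<rho> a"
  using total_deriv_simps(3)[of \<rho> a "- a"] total_deriv_simps(1)[of \<rho> 0]
  by (metis add.right_inverse eq_neg_iff_add_eq_0 add.commute of_real_0)

lemma total_deriv_diff [simp]: "\<partial> \<rho> (a - b) = \<partial> \<rho> a - \<partial> \<rho> b"
  using total_deriv_simps(3)[of \<rho> a "- b"] by simp

lemma total_deriv_0 [simp]: "\<partial> \<rho> 0 = 0"
  using total_deriv_simps(1)[of \<rho> 0] by simp

lemma gamma_0 [simp]: "\<gamma> 0 = 0"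
  using gamma_simps(1)[of 0] by simp

lemma grade_inv_0 [simp]: "grade_inv 0 = 0"
  using grade_inv_simps(1)[of 0] by simp

lemma total_deriv_commute: "\<partial> \<rho> (\<partial> \<sigma> a) = \<partial> \<sigma> (\<partial> \<rho> a)"
proof (induction a)
  case (gen g)
  then show ?case by (cases g) (simp_all add: add_mset_commute)
qed (simp_all add: algebra_simps)

lemma grade_inv_total_deriv: "grade_inv (\<partial> \<rho> a) = \<partial> \<rho> (grade_inv a)"
proof (induction a)
  case (gen g)
  then show ?case by (cases g) (simp_all add: odd_gen_component)
qed simp_all

lemma gamma_total_deriv: "\<gamma> (\<partial> \<rho> a) = \<partial> \<rho> (\<gamma> a)"
proof (induction a)
  case (gen g)
  then show ?case
    by (cases g rule: gamma_gen.cases) (simp_all add: add_mset_commute scaleR_2)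
qed (simp_all add: grade_inv_total_deriv algebra_simps)

lemma grade_inv_gamma: "grade_inv (\<gamma> a) = - \<gamma> (grade_inv a)"
proof (induction a)
  case (gen g)
  then show ?case
    by (cases g rule: gamma_gen.cases) (simp_all add: scaleR_2)
qed (simp_all add: algebra_simps)

lemma gamma_gamma: "\<gamma> (\<gamma> a) = 0"
proof (induction a)
  case (gen g)
  show ?case
  proof (cases g rule: gamma_gen.cases)
    case (1 M \<mu> \<nu> \<alpha> \<beta>)
    have anti: "jet Field N (Col2 b a) = - jet Field N (Col2 a b)" for N a b
      by (rule jet_sym2)
    show ?thesis
      by (simp add: 1 scaleR_2 add_mset_commute anti[of _ \<beta> \<nu>] anti[of _ \<alpha> \<nu>]
          anti[of _ \<beta> \<mu>] anti[of _ \<alpha> \<mu>])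
  qed (simp_all add: scaleR_2)
qed (simp_all add: grade_inv_gamma algebra_simps)


section \<open>Invariant polynomials and gradings\<close>

definition polynomials_in :: "'d local_form set \<Rightarrow> 'd local_form set" where
  "polynomials_in X = span {prod_list xs |xs. set xs \<subseteq> X}"

definition curvature :: "'d \<Rightarrow> 'd \<Rightarrow> 'd \<Rightarrow> 'd \<Rightarrow> 'd \<Rightarrow> 'd \<Rightarrow> 'd local_form" where
  "curvature \<mu> \<nu> \<kappa> \<alpha> \<beta> \<delta> = (let t = \<lambda>\<mu> \<nu> \<alpha> \<beta>. jet Field {#} (Col22 \<mu> \<nu> \<alpha> \<beta>) in
       \<partial> \<kappa> (\<partial> \<delta> (t \<mu> \<nu> \<alpha> \<beta>)) + \<partial> \<kappa> (\<partial> \<alpha> (t \<mu> \<nu> \<beta> \<delta>)) + \<partial> \<kappa> (\<partial> \<beta> (t \<mu> \<nu> \<delta> \<alpha>))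
     + \<partial> \<mu> (\<partial> \<delta> (t \<nu> \<kappa> \<alpha> \<beta>)) + \<partial> \<mu> (\<partial> \<alpha> (t \<nu> \<kappa> \<beta> \<delta>)) + \<partial> \<mu> (\<partial> \<beta> (t \<nu> \<kappa> \<delta> \<alpha>))
     + \<partial> \<nu> (\<partial> \<delta> (t \<kappa> \<mu> \<alpha> \<beta>)) + \<partial> \<nu> (\<partial> \<alpha> (t \<kappa> \<mu> \<beta> \<delta>)) + \<partial> \<nu> (\<partial> \<beta> (t \<kappa> \<mu> \<delta> \<alpha>)))"

lemma gamma_curvature: "\<gamma> (curvature \<mu> \<nu> \<kappa> \<alpha> \<beta> \<delta>) = 0"
  by (simp add: curvature_def Let_def add_mset_commute)

definition invariant_generators :: "'d local_form set" where
  "invariant_generators =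
     {jet Antifield M c |M c. True}
   \<union> {foldr \<partial> \<rho>s (curvature \<mu> \<nu> \<kappa> \<alpha> \<beta> \<delta>) |\<rho>s \<mu> \<nu> \<kappa> \<alpha> \<beta> \<delta>. True}
   \<union> {dx \<mu> |\<mu>. True}"

definition invariant_polynomials :: "'d local_form set" where
  "invariant_polynomials = polynomials_in invariant_generators"

text \<open>The span of the monomials in the jet variables and form generators whose total weight
  satisfies \<open>P\<close>; for an additive grading this is the sum of the homogeneous subspaces selected
  by \<open>P\<close>.\<close>

definition graded_part :: "('d generator \<Rightarrow> nat) \<Rightarrow> (nat \<Rightarrow> bool) \<Rightarrow> 'd local_form set" where
  "graded_part w P = span {prod_list (map gen gs) |gs. P (sum_list (map w gs))}"

definition positive_agh :: "'d local_form set" where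
  "positive_agh = graded_part agh (\<lambda>k. k > 0)"

definition form_degree_less :: "nat \<Rightarrow> 'd local_form set" where
  "form_degree_less n = graded_part form_deg (\<lambda>k. k < n)"

end

theory Submission
  imports Defs
begin

text \<open>The argument is that of the Koszul complex. Let \<open>K\<^sub>\<mu>\<close> be the derivation that removes a derivative
  index \<open>\<mu>\<close> from an antifield jet, weighted by antighost number and multiplicity, and that kills the
  fields and the \<open>dx\<close>. Then \<open>[K\<^sub>\<mu>, \<partial>\<^sub>\<nu>] = \<delta>\<^sub>\<mu>\<^sub>\<nu> N\<close> with \<open>N\<close> the antighost number operator, so at
  antighost number \<open>n > 0\<close> the \<open>\<partial>\<^sub>\<nu>\<close> act like multiplication by variables and the \<open>K\<^sub>\<mu>\<close> like
  partial derivatives. With \<open>h = \<Sum> i\<^sub>\<mu> K\<^sub>\<mu>\<close>, where \<open>i\<^sub>\<mu>\<close> is contraction, one gets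
  \<open>d h + h d = \<Sum> \<partial>\<^sub>\<mu> K\<^sub>\<mu> + N (D - deg)\<close>, which on forms of degree \<open>p\<close> is annihilated by a product of
  factors with roots \<open>n (k + D - p) \<noteq> 0\<close>; hence closed forms are exact. All
  operators preserve the invariant polynomials, because \<open>K\<^sub>\<mu>\<close> and \<open>i\<^sub>\<mu>\<close> vanish on the curvature.\<close>

section \<open>Twisted derivations of the algebra of local forms\<close>

primrec derivation_expr ::
    "('d local_form \<Rightarrow> 'd local_form) \<Rightarrow> ('d generator \<Rightarrow> 'd local_form) \<Rightarrow> 'd expr \<Rightarrow> 'd local_form" where
  "derivation_expr \<sigma> f (Const r) = 0"
| "derivation_expr \<sigma> f (Gen g) = f g"
| "derivation_expr \<sigma> f (Add a b) = derivation_expr \<sigma> f a + derivation_expr \<sigma> f b"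
| "derivation_expr \<sigma> f (Mult a b) =
    derivation_expr \<sigma> f a * abs_local_form b + \<sigma> (abs_local_form a) * derivation_expr \<sigma> f b"

text \<open>A lift to the quotient would need compatibility with \<open>form_eq\<close> for every
  \<open>\<sigma>\<close> and \<open>f\<close>, which fails in general. A representative is chosen
  instead; under the locale assumptions below, \<open>derivation_abs\<close> shows that the choice
  does not matter.\<close>

definition derivation ::
    "('d local_form \<Rightarrow> 'd local_form) \<Rightarrow> ('d generator \<Rightarrow> 'd local_form) \<Rightarrow> 'd local_form \<Rightarrow> 'd local_form" where
  "derivation \<sigma> f x = derivation_expr \<sigma> f (rep_local_form x)"

text \<open>Even and odd derivations share this frame: the twist is the identity for the former and
  \<open>grade_inv\<close> for the latter.\<close>

locale twisted_derivation =
  fixes \<sigma> T :: "'d local_form \<Rightarrow> 'd local_form"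
  assumes twist_of_real: "\<sigma> (of_real r) = of_real r"
    and deriv_of_real: "T (of_real r) = 0"
    and deriv_add: "T (a + b) = T a + T b"
    and deriv_mult: "T (a * b) = T a * b + \<sigma> a * T b"
begin

lemma linear_deriv: "linear T"
  by (rule linearI)
    (simp_all add: deriv_add deriv_mult deriv_of_real twist_of_real scaleR_conv_of_real)

lemmas deriv_0 = linear_0[OF linear_deriv]
  and deriv_diff = linear_diff[OF linear_deriv]
  and deriv_uminus = linear_neg[OF linear_deriv]
  and deriv_sum = linear_sum[OF linear_deriv]
  and deriv_scaleR = linear_cmul[OF linear_deriv]

lemma deriv_1: "T 1 = 0"
  using deriv_of_real[of 1] by simp

end

text \<open>The assumptions on \<open>f\<close> are the defining relations of the algebra, graded
  commutativity and the index symmetries, differentiated by the twisted Leibniz rule. Once the twist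
  is a unital algebra endomorphism, they are what makes values on generators extend to the
  quotient.\<close>

locale derivation_on_generators =
  fixes \<sigma> :: "'d local_form \<Rightarrow> 'd local_form" and f :: "'d generator \<Rightarrow> 'd local_form"
  assumes twist_of_real: "\<And>r. \<sigma> (of_real r) = of_real r"
    and twist_add: "\<And>a b. \<sigma> (a + b) = \<sigma> a + \<sigma> b"
    and twist_mult: "\<And>a b. \<sigma> (a * b) = \<sigma> a * \<sigma> b"
    and comm: "\<And>g h. f g * gen h + \<sigma> (gen g) * f h =
      (if odd_gen g \<and> odd_gen h then - (f h * gen g + \<sigma> (gen h) * f g)
       else f h * gen g + \<sigma> (gen h) * f g)"
    and f_sym22_1: "\<And>k M \<mu> \<nu> \<alpha> \<beta>. f (Jet k M (Col22 \<nu> \<mu> \<alpha> \<beta>)) = - f (Jet k M (Col22 \<mu> \<nu> \<alpha> \<beta>))"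
    and f_sym22_2: "\<And>k M \<mu> \<nu> \<alpha> \<beta>. f (Jet k M (Col22 \<mu> \<nu> \<beta> \<alpha>)) = - f (Jet k M (Col22 \<mu> \<nu> \<alpha> \<beta>))"
    and f_sym22_3: "\<And>k M \<mu> \<nu> \<alpha> \<beta>. f (Jet k M (Col22 \<alpha> \<beta> \<mu> \<nu>)) = f (Jet k M (Col22 \<mu> \<nu> \<alpha> \<beta>))"
    and f_cyc22: "\<And>k M \<mu> \<nu> \<alpha> \<beta>. f (Jet k M (Col22 \<mu> \<nu> \<alpha> \<beta>)) +
      (f (Jet k M (Col22 \<nu> \<alpha> \<mu> \<beta>)) + f (Jet k M (Col22 \<alpha> \<mu> \<nu> \<beta>))) = 0"
    and f_sym21: "\<And>k M \<mu> \<nu> \<alpha>. f (Jet k M (Col21 \<nu> \<mu> \<alpha>)) = - f (Jet k M (Col21 \<mu> \<nu> \<alpha>))"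
    and f_cyc21: "\<And>k M \<mu> \<nu> \<alpha>. f (Jet k M (Col21 \<mu> \<nu> \<alpha>)) +
      (f (Jet k M (Col21 \<nu> \<alpha> \<mu>)) + f (Jet k M (Col21 \<alpha> \<mu> \<nu>))) = 0"
    and f_sym2: "\<And>k M \<mu> \<nu>. f (Jet k M (Col2 \<nu> \<mu>)) = - f (Jet k M (Col2 \<mu> \<nu>))"
begin

lemma twist_minus_one: "\<sigma> (- 1) = - 1"
  using twist_of_real[of "- 1"] by simp

lemma twist_0: "\<sigma> 0 = 0" and twist_1: "\<sigma> 1 = 1"
  using twist_of_real[of 0] twist_of_real[of 1] by simp_all

lemma derivation_expr_cong: "a \<approx> b \<Longrightarrow> derivation_expr \<sigma> f a = derivation_expr \<sigma> f b"
proof (induction rule: form_eq.induct)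
  case (graded_comm g h)
  then show ?case
    using comm[of g h] by (auto simp: abs_simps twist_minus_one twist_1)
next
  case (mult_cong a a' b b')
  then show ?case by (simp add: abs_eqI)
next
  case (const_central a r)
  then show ?case by (simp add: abs_simps twist_of_real) (simp add: of_real_def)
qed (auto simp: abs_simps twist_of_real twist_0 twist_1 twist_minus_one twist_add twist_mult
      algebra_simps f_cyc22 f_cyc21
      intro: f_sym22_1 f_sym22_2 f_sym22_3 f_sym21 f_sym2)

lemma derivation_abs: "derivation \<sigma> f (abs_local_form a) = derivation_expr \<sigma> f a"
  unfolding derivation_def
  by (rule derivation_expr_cong)
    (metis Quotient_abs_rep[OF Quotient_local_form] local_form.abs_eq_iff)

lemma derivation_gen: "derivation \<sigma> f (gen g) = f g"
  by (simp flip: abs_Gen add: derivation_abs)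

lemma twisted_derivation: "twisted_derivation \<sigma> (derivation \<sigma> f)"
proof
  fix r and a b :: "'d local_form"
  show "\<sigma> (of_real r) = of_real r" by (rule twist_of_real)
  show "derivation \<sigma> f (of_real r) = 0"
    by (simp flip: abs_Const add: derivation_abs)
  show "derivation \<sigma> f (a + b) = derivation \<sigma> f a + derivation \<sigma> f b"
    by (induction a rule: local_form.abs_induct, induction b rule: local_form.abs_induct)
      (simp flip: abs_Add add: derivation_abs)
  show "derivation \<sigma> f (a * b) = derivation \<sigma> f a * b + \<sigma> a * derivation \<sigma> f b"
    by (induction a rule: local_form.abs_induct, induction b rule: local_form.abs_induct)
      (simp flip: abs_Mult add: derivation_abs)
qed

end

interpretation total_deriv: twisted_derivation "\<lambda>a. a" "\<partial> \<rho>"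
  by standard simp_all

section \<open>Antighost number, index removal and contraction as derivations\<close>

lemma agh_jet: "agh (Jet k M c) = agh (Jet k {#} c)"
  by (cases k; cases c) simp_all

lemma odd_gen_jet: "odd_gen (Jet k M c) = odd_gen (Jet k {#} c)"
  by (cases k) simp_all

fun agh_gen :: "'d generator \<Rightarrow> 'd local_form" where
  "agh_gen g = real (agh g) *\<^sub>R gen g"

text \<open>Reading the derivative indices of a jet as a monomial, the factor \<open>count\<close>
  makes this a partial derivative. The factor \<open>agh\<close> turns the commutator with total
  derivatives into the antighost number operator, and it makes all fields constants. If
  \<open>\<mu>\<close> does not occur in \<open>M\<close>, the coefficient is 0, so the truncated
  difference \<open>M - {#\<mu>#}\<close> does no harm.\<close>

fun lower_gen :: "'d \<Rightarrow> 'd generator \<Rightarrow> 'd local_form" where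
  "lower_gen \<mu> (Jet k M c) =
    (real (agh (Jet k {#} c)) * real (count M \<mu>)) *\<^sub>R jet k (M - {#\<mu>#}) c"
| "lower_gen \<mu> (Dx \<nu>) = 0"

text \<open>Interior product with a coordinate vector field. It is odd, and its sign rule counts the
  odd jet variables along with the form generators.\<close>

fun contract_gen :: "'d \<Rightarrow> 'd generator \<Rightarrow> 'd local_form" where
  "contract_gen \<mu> (Jet k M c) = 0"
| "contract_gen \<mu> (Dx \<nu>) = (if \<mu> = \<nu> then 1 else 0)"

definition agh_op :: "'d local_form \<Rightarrow> 'd local_form" where
  "agh_op = derivation (\<lambda>a. a) agh_gen"

definition lower :: "'d \<Rightarrow> 'd local_form \<Rightarrow> 'd local_form" where
  "lower \<mu> = derivation (\<lambda>a. a) (lower_gen \<mu>)"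

definition contract :: "'d \<Rightarrow> 'd local_form \<Rightarrow> 'd local_form" where
  "contract \<mu> = derivation grade_inv (contract_gen \<mu>)"

lemma agh_shape [simp]:
  "agh (Jet k M (Col22 \<mu> \<nu> \<alpha> \<beta>)) = (if k = Field then 0 else 1)"
  "agh (Jet k M (Col21 \<mu> \<nu> \<alpha>)) = (if k = Field then 0 else 2)"
  "agh (Jet k M (Col2 \<mu> \<nu>)) = (if k = Field then 0 else 3)"
  by (cases k; simp)+

lemma scaleR_sum3_eq_0:
  "a + (b + c) = 0 \<Longrightarrow> r *\<^sub>R a + (r *\<^sub>R b + r *\<^sub>R c) = 0" for a b c :: "'a::real_vector"
  by (metis scaleR_right_distrib scaleR_zero_right)

text \<open>Such an \<open>f\<close> keeps the component, hence the parity. Its coefficient depends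
  on the component only through the antighost number, so all terms of one index symmetry carry the
  same scalar and the symmetry survives.\<close>

lemma even_derivation_on_generators:
  assumes jet: "\<And>k M c. f (Jet k M c) = r M (agh (Jet k {#} c)) *\<^sub>R jet k (m M) c"
    and dx: "\<And>\<mu>. f (Dx \<mu>) = 0"
  shows "derivation_on_generators (\<lambda>a. a) f"
proof
  fix k :: sector and M :: "'a multiset" and \<mu> \<nu> \<alpha> \<beta> :: 'a and g h :: "'a generator"
  have "f g * gen h = (if odd_gen g \<and> odd_gen h then - (gen h * f g) else gen h * f g)" for g h
  proof (cases g)
    case (Jet k M c)
    then show ?thesis
      using gen_comm[of "Jet k (m M) c" h] odd_gen_jet[of k "m M" c] odd_gen_jet[of k M c]
      by (simp add: jet)
  qed (simp add: dx)
  from this[of g h] this[of h g]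
  show "f g * gen h + gen g * f h =
      (if odd_gen g \<and> odd_gen h then - (f h * gen g + gen h * f g) else f h * gen g + gen h * f g)"
    by (simp split: if_splits)
  show "f (Jet k M (Col22 \<nu> \<mu> \<alpha> \<beta>)) = - f (Jet k M (Col22 \<mu> \<nu> \<alpha> \<beta>))"
    by (simp add: jet jet_sym22_1[of k _ \<nu> \<mu>])
  show "f (Jet k M (Col22 \<mu> \<nu> \<beta> \<alpha>)) = - f (Jet k M (Col22 \<mu> \<nu> \<alpha> \<beta>))"
    by (simp add: jet jet_sym22_2[of k _ \<mu> \<nu> \<beta>])
  show "f (Jet k M (Col22 \<alpha> \<beta> \<mu> \<nu>)) = f (Jet k M (Col22 \<mu> \<nu> \<alpha> \<beta>))"
    by (simp add: jet jet_sym22_3[of k _ \<alpha> \<beta>])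
  show "f (Jet k M (Col22 \<mu> \<nu> \<alpha> \<beta>)) +
      (f (Jet k M (Col22 \<nu> \<alpha> \<mu> \<beta>)) + f (Jet k M (Col22 \<alpha> \<mu> \<nu> \<beta>))) = 0"
    unfolding jet agh_shape by (rule scaleR_sum3_eq_0[OF jet_cyc22])
  show "f (Jet k M (Col21 \<nu> \<mu> \<alpha>)) = - f (Jet k M (Col21 \<mu> \<nu> \<alpha>))"
    by (simp add: jet jet_sym21[of k _ \<nu> \<mu>])
  show "f (Jet k M (Col21 \<mu> \<nu> \<alpha>)) +
      (f (Jet k M (Col21 \<nu> \<alpha> \<mu>)) + f (Jet k M (Col21 \<alpha> \<mu> \<nu>))) = 0"
    unfolding jet agh_shape by (rule scaleR_sum3_eq_0[OF jet_cyc21])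
  show "f (Jet k M (Col2 \<nu> \<mu>)) = - f (Jet k M (Col2 \<mu> \<nu>))"
    by (simp add: jet jet_sym2[of k _ \<nu> \<mu>])
qed simp_all

lemma derivation_on_generators_agh_gen: "derivation_on_generators (\<lambda>a. a) agh_gen"
proof (rule even_derivation_on_generators[where r = "\<lambda>_. real" and m = "\<lambda>M. M"])
  show "agh_gen (Jet k M c) = real (agh (Jet k {#} c)) *\<^sub>R jet k M c"
    for k M and c :: "'a component"
    using agh_jet[of k M c] by simp
qed simp

lemma derivation_on_generators_lower_gen: "derivation_on_generators (\<lambda>a. a) (lower_gen \<mu>)"
  by (rule even_derivation_on_generators
      [where r = "\<lambda>M w. real w * real (count M \<mu>)" and m = "\<lambda>M. M - {#\<mu>#}"]) simp_all

lemma derivation_on_generators_contract_gen: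
  "derivation_on_generators grade_inv (contract_gen \<mu>)"
proof
  fix g h :: "'a generator"
  show "contract_gen \<mu> g * gen h + grade_inv (gen g) * contract_gen \<mu> h =
      (if odd_gen g \<and> odd_gen h then - (contract_gen \<mu> h * gen g + grade_inv (gen h) * contract_gen \<mu> g)
       else contract_gen \<mu> h * gen g + grade_inv (gen h) * contract_gen \<mu> g)"
    by (cases g; cases h) simp_all
qed simp_all

interpretation agh_op: twisted_derivation "\<lambda>a. a" agh_op
  unfolding agh_op_def
  by (rule derivation_on_generators.twisted_derivation[OF derivation_on_generators_agh_gen])

interpretation lower: twisted_derivation "\<lambda>a. a" "lower \<mu>"
  unfolding lower_def
  by (rule derivation_on_generators.twisted_derivation[OF derivation_on_generators_lower_gen])

interpretation contract: twisted_derivation grade_inv "contract \<mu>"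
  unfolding contract_def
  by (rule derivation_on_generators.twisted_derivation[OF derivation_on_generators_contract_gen])

lemma agh_op_gen [simp]: "agh_op (gen g) = real (agh g) *\<^sub>R gen g"
  unfolding agh_op_def
  by (simp add: derivation_on_generators.derivation_gen[OF derivation_on_generators_agh_gen])

lemma lower_gen [simp]: "lower \<mu> (gen g) = lower_gen \<mu> g"
  unfolding lower_def
  by (rule derivation_on_generators.derivation_gen[OF derivation_on_generators_lower_gen])

lemma contract_gen [simp]: "contract \<mu> (gen g) = contract_gen \<mu> g"
  unfolding contract_def
  by (rule derivation_on_generators.derivation_gen[OF derivation_on_generators_contract_gen])

declare agh_op.deriv_of_real [simp] agh_op.deriv_add [simp] agh_op.deriv_mult [simp]
  agh_op.deriv_scaleR [simp] agh_op.deriv_0 [simp]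
  lower.deriv_of_real [simp] lower.deriv_add [simp] lower.deriv_mult [simp]
  lower.deriv_scaleR [simp] lower.deriv_0 [simp] lower.deriv_uminus [simp] lower.deriv_diff [simp]
  contract.deriv_of_real [simp] contract.deriv_add [simp] contract.deriv_mult [simp]
  contract.deriv_scaleR [simp] contract.deriv_0 [simp] contract.deriv_uminus [simp]
  contract.deriv_diff [simp] contract.deriv_1 [simp]
  total_deriv.deriv_scaleR [simp] total_deriv.deriv_1 [simp]


section \<open>Commutation relations\<close>

text \<open>The Heisenberg relation of the Koszul argument. Adding \<open>\<nu>\<close> to the
  indices of a jet raises the multiplicity of \<open>\<mu>\<close> by one exactly when the two
  agree, and the surplus is the antighost number times the jet. All operators involved are untwisted
  derivations, so products follow from generators.\<close>

lemma lower_total_deriv: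
  "lower \<mu> (\<partial> \<nu> a) = \<partial> \<nu> (lower \<mu> a) + (if \<mu> = \<nu> then agh_op a else 0)"
proof (induction a)
  case (gen g)
  show ?case
  proof (cases g)
    case (Jet k M c)
    show ?thesis
    proof (cases "\<mu> \<in># M")
      case True
      then show ?thesis
        by (auto simp: Jet agh_jet[of k M] algebra_simps)
    next
      case False
      then have "count M \<mu> = 0" by (simp add: not_in_iff)
      then show ?thesis
        by (auto simp: Jet agh_jet[of k M] diff_single_trivial)
    qed
  qed simp
qed (simp_all add: algebra_simps)

lemma agh_op_total_deriv: "agh_op (\<partial> \<nu> a) = \<partial> \<nu> (agh_op a)"
proof (induction a)
  case (gen g)
  show ?case
  proof (cases g)
    case (Jet k M c)
    then show ?thesis using agh_jet[of k M c] agh_jet[of k "add_mset \<nu> M" c] by simp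
  qed simp
qed (simp_all add: algebra_simps)

lemma agh_op_lower: "agh_op (lower \<mu> a) = lower \<mu> (agh_op a)"
proof (induction a)
  case (gen g)
  show ?case
  proof (cases g)
    case (Jet k M c)
    then show ?thesis
      using agh_jet[of k M c] agh_jet[of k "M - {#\<mu>#}" c] by simp
  qed simp
qed (simp_all add: algebra_simps)

lemma contract_total_deriv: "contract \<mu> (\<partial> \<nu> a) = \<partial> \<nu> (contract \<mu> a)"
proof (induction a)
  case (gen g)
  show ?case by (cases g) simp_all
qed (simp_all add: algebra_simps grade_inv_total_deriv)

lemma grade_inv_1 [simp]: "grade_inv 1 = 1"
  using grade_inv_simps(1)[of 1] by simp

lemma grade_inv_scaleR [simp]: "grade_inv (r *\<^sub>R a) = r *\<^sub>R grade_inv a"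
  by (simp add: scaleR_conv_of_real)

lemma grade_inv_lower: "grade_inv (lower \<mu> a) = lower \<mu> (grade_inv a)"
proof (induction a)
  case (gen g)
  show ?case
  proof (cases g)
    case (Jet k M c)
    then show ?thesis
      using odd_gen_jet[of k M c] odd_gen_jet[of k "M - {#\<mu>#}" c] by simp
  qed simp
qed simp_all

lemma contract_lower: "contract \<mu> (lower \<nu> a) = lower \<nu> (contract \<mu> a)"
proof (induction a)
  case (gen g)
  show ?case by (cases g) (simp_all add: lower.deriv_1)
qed (simp_all add: algebra_simps grade_inv_lower)

text \<open>Moving an odd generator past a form costs the parity sign of that form. This cancels the
  twist of \<open>contract\<close> in \<open>degree_op\<close>.\<close>

lemma dx_commute: "dx \<mu> * grade_inv a = a * dx \<mu>"
proof (induction a)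
  case (const r)
  then show ?case by (simp add: of_real_def)
next
  case (gen g)
  then show ?case using gen_comm[of "Dx \<mu>" g] by simp
next
  case (mult a b)
  then show ?case by (simp flip: mult.assoc) (simp add: mult.assoc)
qed (simp add: algebra_simps)

definition degree_op :: "'d::finite local_form \<Rightarrow> 'd local_form" where
  "degree_op a = (\<Sum>\<mu>\<in>UNIV. dx \<mu> * contract \<mu> a)"

text \<open>Multiplying the odd derivation \<open>contract \<mu>\<close> by the odd
  \<open>dx \<mu>\<close> gives an even derivation; it counts form generators, since it fixes each
  \<open>dx\<close> and kills jets.\<close>

interpretation degree_op: twisted_derivation "\<lambda>a. a" degree_op
proof
  fix a b :: "'a local_form"
  have "dx \<mu> * (contract \<mu> a * b + grade_inv a * contract \<mu> b) =
      dx \<mu> * contract \<mu> a * b + a * (dx \<mu> * contract \<mu> b)" for \<mu>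
    by (simp add: ring_distribs dx_commute flip: mult.assoc)
  then show "degree_op (a * b) = degree_op a * b + a * degree_op b"
    by (simp add: degree_op_def sum.distrib sum_distrib_left sum_distrib_right)
qed (simp_all add: degree_op_def sum.distrib ring_distribs)

lemma degree_op_gen: "degree_op (gen g) = real (form_deg g) *\<^sub>R gen g"
proof (cases g)
  case (Dx \<nu>)
  have "(\<Sum>\<mu>\<in>UNIV. dx \<mu> * (if \<mu> = \<nu> then 1 else 0)) = (\<Sum>\<mu>\<in>UNIV. if \<mu> = \<nu> then dx \<mu> else 0)"
    by (rule sum.cong) auto
  then show ?thesis by (simp add: Dx degree_op_def)
qed (simp add: degree_op_def)

lemma degree_op_total_deriv: "degree_op (\<partial> \<nu> a) = \<partial> \<nu> (degree_op a)"
  by (simp add: degree_op_def total_deriv.deriv_sum contract_total_deriv)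

lemma degree_op_lower: "degree_op (lower \<nu> a) = lower \<nu> (degree_op a)"
  by (simp add: degree_op_def lower.deriv_sum contract_lower)


section \<open>The homotopy and its Laplacian\<close>

definition homotopy :: "'d::finite local_form \<Rightarrow> 'd local_form" where
  "homotopy a = (\<Sum>\<mu>\<in>UNIV. contract \<mu> (lower \<mu> a))"

definition euler_op :: "'d::finite local_form \<Rightarrow> 'd local_form" where
  "euler_op a = (\<Sum>\<mu>\<in>UNIV. \<partial> \<mu> (lower \<mu> a))"

definition laplacian :: "'d::finite local_form \<Rightarrow> 'd local_form" where
  "laplacian a = ext_d (homotopy a) + homotopy (ext_d a)"

lemma linear_homotopy: "linear homotopy"
  by (rule linearI) (simp_all add: homotopy_def sum.distrib scaleR_sum_right)

lemma linear_ext_d: "linear ext_d"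
  by (rule linearI) (simp_all add: ext_d_def sum.distrib scaleR_sum_right ring_distribs)

lemma linear_laplacian: "linear laplacian"
  by (rule linearI)
    (simp_all add: laplacian_def linear_add[OF linear_ext_d] linear_add[OF linear_homotopy]
      linear_cmul[OF linear_ext_d] linear_cmul[OF linear_homotopy] scaleR_right_distrib)

lemma ext_d_ext_d: "ext_d (ext_d a) = 0"
proof -
  have "ext_d (ext_d a) = (\<Sum>\<mu>\<in>UNIV. \<Sum>\<nu>\<in>UNIV. dx \<mu> * (dx \<nu> * \<partial> \<mu> (\<partial> \<nu> a)))"
    by (simp add: ext_d_def total_deriv.deriv_sum sum_distrib_left)
  also have "\<dots> = (\<Sum>\<mu>\<in>UNIV. \<Sum>\<nu>\<in>UNIV. - (dx \<nu> * (dx \<mu> * \<partial> \<nu> (\<partial> \<mu> a))))"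
  proof (intro sum.cong HOL.refl)
    fix \<mu> \<nu>
    show "dx \<mu> * (dx \<nu> * \<partial> \<mu> (\<partial> \<nu> a)) = - (dx \<nu> * (dx \<mu> * \<partial> \<nu> (\<partial> \<mu> a)))"
      using gen_comm[of "Dx \<mu>" "Dx \<nu>"]
      by (simp add: total_deriv_commute[of \<mu>] flip: mult.assoc)
  qed
  also have "\<dots> = - (\<Sum>\<nu>\<in>UNIV. \<Sum>\<mu>\<in>UNIV. dx \<nu> * (dx \<mu> * \<partial> \<nu> (\<partial> \<mu> a)))"
    by (subst sum.swap) (simp add: sum_negf)
  also have "\<dots> = - ext_d (ext_d a)"
    by (simp add: ext_d_def total_deriv.deriv_sum sum_distrib_left)
  finally have "2 *\<^sub>R ext_d (ext_d a) = 0"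
    by (metis add.right_inverse scaleR_2)
  then show ?thesis by simp
qed

lemma laplacian_eq:
  fixes a :: "'d::finite local_form"
  shows "laplacian a = euler_op a + real CARD('d) *\<^sub>R agh_op a - degree_op (agh_op a)"
proof -
  have dh: "ext_d (homotopy a) = (\<Sum>\<mu>\<in>UNIV. \<Sum>\<nu>\<in>UNIV. dx \<nu> * \<partial> \<nu> (contract \<mu> (lower \<mu> a)))"
    unfolding ext_d_def homotopy_def
    by (subst sum.swap) (simp add: total_deriv.deriv_sum sum_distrib_left)
  \<comment> \<open>The last term cancels the matching summand of \<open>ext_d (homotopy a)\<close>.
    What survives is diagonal: the Heisenberg relation supplies one \<open>agh_op a\<close> per
    direction, and its product with the contraction, summed over directions, is the form
    degree.\<close>
  have summand: "contract \<mu> (lower \<mu> (dx \<nu> * \<partial> \<nu> a)) =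
      (if \<nu> = \<mu> then \<partial> \<nu> (lower \<nu> a) + agh_op a - dx \<nu> * contract \<nu> (agh_op a) else 0)
      - dx \<nu> * \<partial> \<nu> (contract \<mu> (lower \<mu> a))" for \<mu> \<nu>
    by (simp add: lower_total_deriv contract_total_deriv algebra_simps)
  have hd: "homotopy (ext_d a) =
      (\<Sum>\<mu>\<in>UNIV. \<Sum>\<nu>\<in>UNIV. contract \<mu> (lower \<mu> (dx \<nu> * \<partial> \<nu> a)))"
    unfolding ext_d_def homotopy_def by (simp only: lower.deriv_sum contract.deriv_sum)
  show ?thesis
    unfolding laplacian_def dh hd summand
    by (simp add: sum_subtractf sum.distrib euler_op_def degree_op_def scaleR_conv_of_real)
qed

section \<open>Polynomials in a linear operator, given by their roots\<close>

definition compose_shifted :: "('a \<Rightarrow> 'a) \<Rightarrow> real list \<Rightarrow> 'a \<Rightarrow> 'a::real_vector" where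
  "compose_shifted f ls = foldr (\<lambda>c g x. f (g x) - c *\<^sub>R g x) ls id"

lemma compose_shifted_Nil [simp]: "compose_shifted f [] a = a"
  and compose_shifted_Cons [simp]:
    "compose_shifted f (c # ls) a = f (compose_shifted f ls a) - c *\<^sub>R compose_shifted f ls a"
  by (simp_all add: compose_shifted_def)

lemma compose_shifted_append:
  "compose_shifted f (ls @ ms) a = compose_shifted f ls (compose_shifted f ms a)"
  by (induction ls) simp_all

lemma linear_compose_shifted: "linear f \<Longrightarrow> linear (compose_shifted f ls)"
  by (induction ls)
    (auto intro!: linearI simp: linear_add linear_cmul algebra_simps)

lemma compose_shifted_self:
  "linear f \<Longrightarrow> compose_shifted f ls (f a) = f (compose_shifted f ls a)"
  by (induction ls) (simp_all add: linear_diff linear_cmul)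

lemma compose_shifted_commute:
  assumes "linear f"
  shows "compose_shifted f ls (compose_shifted f ms a) = compose_shifted f ms (compose_shifted f ls a)"
proof (induction ms)
  case (Cons c ms)
  then show ?case
    using linear_compose_shifted[OF assms, of ls]
    by (simp add: linear_diff linear_cmul compose_shifted_self[OF assms])
qed simp

lemma compose_shifted_eigenvector:
  assumes "linear f" and "f a = c *\<^sub>R a"
  shows "compose_shifted f ls a = (\<Prod>l\<leftarrow>ls. c - l) *\<^sub>R a"
  using assms by (induction ls) (simp_all add: linear_cmul algebra_simps)

text \<open>The sum of the generalized eigenspaces of \<open>f\<close> for nonzero real eigenvalues.
  Lists may repeat a root, so \<open>f\<close> need not be diagonalizable there.\<close>

definition annihilated :: "('a \<Rightarrow> 'a) \<Rightarrow> 'a::real_vector set" where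
  "annihilated f = {a. \<exists>ls. 0 \<notin> set ls \<and> compose_shifted f ls a = 0}"

lemma subspace_annihilated:
  assumes "linear f"
  shows "subspace (annihilated f)"
proof (rule subspaceI)
  show "0 \<in> annihilated f"
    by (auto simp: annihilated_def intro!: exI[of _ "[]"])
next
  fix a b assume "a \<in> annihilated f" and "b \<in> annihilated f"
  then obtain ls ms where "0 \<notin> set ls" "compose_shifted f ls a = 0"
      and "0 \<notin> set ms" "compose_shifted f ms b = 0"
    by (auto simp: annihilated_def)
  then have "0 \<notin> set (ls @ ms) \<and> compose_shifted f (ls @ ms) (a + b) = 0"
    using compose_shifted_commute[OF assms, of ls ms a] linear_compose_shifted[OF assms]
    by (simp add: compose_shifted_append linear_add linear_0)
  then show "a + b \<in> annihilated f"
    unfolding annihilated_def by blast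
next
  fix r a assume "a \<in> annihilated f"
  then show "r *\<^sub>R a \<in> annihilated f"
    using linear_compose_shifted[OF assms] by (auto simp: annihilated_def linear_cmul)
qed

text \<open>On a closed \<open>a\<close> the Laplacian gives \<open>d (h a)\<close>, which is exact.
  Induction removes one root \<open>c\<close> at a time: \<open>L a - c *\<^sub>R a\<close> is again
  closed and is killed by the shorter product, hence equals some \<open>d b\<close>. Then
  \<open>c *\<^sub>R a = d (h a - b)\<close>, and \<open>c\<close> is invertible.\<close>

lemma exact_of_annihilated:
  fixes d h :: "'a::real_vector \<Rightarrow> 'a"
  assumes lin: "linear d" "linear h" and dd: "\<And>a. d (d a) = 0"
    and S: "subspace S" "\<And>a. a \<in> S \<Longrightarrow> d a \<in> S" "\<And>a. a \<in> S \<Longrightarrow> h a \<in> S"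
    and a: "a \<in> S" "d a = 0" "a \<in> annihilated (\<lambda>x. d (h x) + h (d x))"
  shows "\<exists>b\<in>S. a = d b"
proof -
  define L where "L = (\<lambda>x. d (h x) + h (d x))"
  have linL: "linear L"
    by (rule linearI) (simp_all add: L_def lin linear_add linear_cmul scaleR_right_distrib)
  have "\<exists>b\<in>S. a = d b"
    if "a \<in> S" "d a = 0" "0 \<notin> set ls" "compose_shifted L ls a = 0" for ls a
    using that
  proof (induction ls arbitrary: a)
    case Nil
    then show ?case using subspace_0[OF S(1)] linear_0[OF lin(1)] by auto
  next
    case (Cons c ls)
    have La: "L a = d (h a)"
      using Cons.prems linear_0[OF lin(2)] by (simp add: L_def)
    \<comment> \<open>The factor for \<open>c\<close> is outermost in
      \<open>compose_shifted\<close>; it moves inside because polynomials in \<open>L\<close>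
      commute with \<open>L\<close>.\<close>
    have "compose_shifted L ls (L a - c *\<^sub>R a) = 0"
      using Cons.prems linear_compose_shifted[OF linL, of ls]
      by (simp add: linear_diff linear_cmul compose_shifted_self[OF linL])
    moreover have "L a - c *\<^sub>R a \<in> S"
      unfolding La using Cons.prems S by (simp add: subspace_diff subspace_scale)
    moreover have "d (L a - c *\<^sub>R a) = 0"
      unfolding La using Cons.prems lin by (simp add: linear_diff linear_cmul dd)
    ultimately obtain b where b: "b \<in> S" "L a - c *\<^sub>R a = d b"
      using Cons.IH[of "L a - c *\<^sub>R a"] Cons.prems by auto
    from b(2) have "c *\<^sub>R a = d (h a) - d b"
      by (simp add: La algebra_simps)
    then have "inverse c *\<^sub>R c *\<^sub>R a = d (inverse c *\<^sub>R (h a - b))"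
      using lin by (simp only: linear_diff linear_cmul)
    then have "a = d (inverse c *\<^sub>R (h a - b))"
      using Cons.prems by simp
    moreover have "inverse c *\<^sub>R (h a - b) \<in> S"
      using Cons.prems S b by (simp add: subspace_diff subspace_scale)
    ultimately show ?case by blast
  qed
  then show ?thesis using a by (auto simp: annihilated_def L_def)
qed

section \<open>The nilpotency filtration and the spectrum of the Laplacian\<close>

primrec lower_nilpotent :: "nat \<Rightarrow> 'd local_form \<Rightarrow> bool" where
  "lower_nilpotent 0 a \<longleftrightarrow> a = 0"
| "lower_nilpotent (Suc m) a \<longleftrightarrow> (\<forall>\<mu>. lower_nilpotent m (lower \<mu> a))"

lemma lower_nilpotent_0 [simp]: "lower_nilpotent m 0"
  by (induction m) simp_all

lemma lower_nilpotent_Suc: "lower_nilpotent m a \<Longrightarrow> lower_nilpotent (Suc m) a"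
  by (induction m arbitrary: a) simp_all

lemma lower_nilpotent_mono: "lower_nilpotent m a \<Longrightarrow> m \<le> n \<Longrightarrow> lower_nilpotent n a"
  by (rule dec_induct[where P = "\<lambda>n. lower_nilpotent n a"]) (blast intro: lower_nilpotent_Suc)+

lemma lower_nilpotent_add:
  "lower_nilpotent m a \<Longrightarrow> lower_nilpotent m b \<Longrightarrow> lower_nilpotent m (a + b)"
  by (induction m arbitrary: a b) simp_all

lemma lower_nilpotent_scaleR: "lower_nilpotent m a \<Longrightarrow> lower_nilpotent m (r *\<^sub>R a)"
  by (induction m arbitrary: a) simp_all

text \<open>By the Leibniz rule each lowering spends one unit of the bound of one factor, and a
  factor whose bound reaches 0 is itself 0.\<close>

lemma lower_nilpotent_mult:
  "lower_nilpotent m a \<Longrightarrow> lower_nilpotent n b \<Longrightarrow> lower_nilpotent (m + n) (a * b)"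
proof (induction "m + n" arbitrary: m n a b)
  case (Suc k)
  show ?case
  proof (cases m; cases n)
    fix m' n' assume mn: "m = Suc m'" "n = Suc n'"
    have "lower_nilpotent (m' + n) (lower \<mu> a * b)" and "lower_nilpotent (m + n') (a * lower \<mu> b)" for \<mu>
      using Suc.hyps(2) Suc.prems unfolding mn lower_nilpotent.simps(2)
      by (intro Suc.hyps(1); simp)+
    moreover have "m' + n = k" and "m + n' = k" using Suc.hyps(2) by (simp_all add: mn)
    ultimately have "lower_nilpotent k (lower \<mu> a * b + a * lower \<mu> b)" for \<mu>
      by (metis lower_nilpotent_add)
    then show ?thesis using Suc.hyps(2)[symmetric] by simp
  qed (use Suc.prems in auto)
qed simp

lemma ex_lower_nilpotent: "\<exists>m. lower_nilpotent m a"
proof (induction a)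
  case (const r)
  have "lower_nilpotent 1 (of_real r)" by simp
  then show ?case by blast
next
  case (gen g)
  show ?case
  proof (cases g)
    case (Jet k M c)
    \<comment> \<open>Each lowering strips one derivative index; one further application kills the
      undifferentiated component.\<close>
    have "lower_nilpotent (Suc n) (jet k M c)" if "size M \<le> n" for n M
      using that
    proof (induction n arbitrary: M)
      case (Suc n)
      have "lower_nilpotent (Suc n) (lower \<mu> (jet k M c))" for \<mu>
      proof (cases "\<mu> \<in># M")
        case True
        then have "size (M - {#\<mu>#}) \<le> n"
          using Suc.prems by (simp add: size_Diff_singleton)
        then show ?thesis
          unfolding lower_gen lower_gen.simps by (rule lower_nilpotent_scaleR[OF Suc.IH])
      next
        case False
        then have "lower \<mu> (jet k M c) = 0" by (simp add: count_eq_zero_iff)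
        then show ?thesis by (simp only: lower_nilpotent_0)
      qed
      then show ?case by (simp only: lower_nilpotent.simps(2)[of "Suc n"]) simp
    qed simp
    then show ?thesis unfolding Jet by blast
  next
    case (Dx \<nu>)
    have "lower_nilpotent 1 (dx \<nu>)" by simp
    then show ?thesis unfolding Dx by blast
  qed
next
  case (add a b)
  then obtain m n where "lower_nilpotent m a" "lower_nilpotent n b" by blast
  then have "lower_nilpotent (max m n) (a + b)"
    by (intro lower_nilpotent_add) (auto elim: lower_nilpotent_mono)
  then show ?case by blast
next
  case (mult a b)
  then show ?case by (blast intro: lower_nilpotent_mult)
qed

text \<open>Stated by eigenvalue equations instead of spanning monomials, so that stability under
  any operator commuting with both number operators is immediate.\<close>

definition homogeneous :: "nat \<Rightarrow> nat \<Rightarrow> 'd::finite local_form set" where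
  "homogeneous n p = {a. agh_op a = real n *\<^sub>R a \<and> degree_op a = real p *\<^sub>R a}"

lemma subspace_homogeneous: "subspace (homogeneous n p)"
  by (rule subspaceI)
    (simp_all add: homogeneous_def degree_op.deriv_0 degree_op.deriv_add degree_op.deriv_scaleR
      scaleR_right_distrib)

lemma lower_homogeneous: "a \<in> homogeneous n p \<Longrightarrow> lower \<mu> a \<in> homogeneous n p"
  by (simp add: homogeneous_def agh_op_lower degree_op_lower)

lemma total_deriv_homogeneous: "a \<in> homogeneous n p \<Longrightarrow> \<partial> \<mu> a \<in> homogeneous n p"
  by (simp add: homogeneous_def agh_op_total_deriv degree_op_total_deriv)

lemma euler_op_homogeneous: "a \<in> homogeneous n p \<Longrightarrow> euler_op a \<in> homogeneous n p"
  unfolding euler_op_def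
  by (intro subspace_sum subspace_homogeneous total_deriv_homogeneous lower_homogeneous)

lemma laplacian_homogeneous:
  "a \<in> homogeneous n p \<Longrightarrow> laplacian a = euler_op a + (real n * (real CARD('d) - real p)) *\<^sub>R a"
  for a :: "'d::finite local_form"
  by (simp add: laplacian_eq homogeneous_def degree_op.deriv_scaleR algebra_simps)

text \<open>The lowering operators commute with each other, so the commutator comes only from the
  Heisenberg relation, where \<open>agh_op\<close> acts as the scalar \<open>n\<close>.\<close>

lemma lower_euler_op:
  assumes "a \<in> homogeneous n p"
  shows "lower \<mu> (euler_op a) = euler_op (lower \<mu> a) + real n *\<^sub>R lower \<mu> a"
proof -
  have lower_lower: "lower \<mu> (lower \<nu> b) = lower \<nu> (lower \<mu> b)" for \<nu> b
  proof (induction b)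
    case (gen g)
    show ?case
    proof (cases g)
      case (Jet k M c)
      then show ?thesis by (cases "\<mu> = \<nu>") (simp_all add: add_mset_commute mult.commute)
    qed simp
  qed (simp_all add: algebra_simps)
  have "lower \<mu> (euler_op a) =
      (\<Sum>\<nu>\<in>UNIV. \<partial> \<nu> (lower \<nu> (lower \<mu> a)) + (if \<mu> = \<nu> then agh_op (lower \<nu> a) else 0))"
    unfolding euler_op_def lower.deriv_sum lower_total_deriv lower_lower ..
  also have "\<dots> = euler_op (lower \<mu> a) + agh_op (lower \<mu> a)"
    by (simp add: sum.distrib euler_op_def)
  finally show ?thesis
    using lower_homogeneous[OF assms, of \<mu>] by (simp add: homogeneous_def)
qed

text \<open>The kernel filtration of the \<open>lower \<mu>\<close> has \<open>euler_op\<close> acting as the scalar \<open>n m\<close> on its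
  \<open>m\<close>-th quotient.\<close>

lemma lower_nilpotent_euler_op:
  "lower_nilpotent (Suc m) a \<Longrightarrow> a \<in> homogeneous n p \<Longrightarrow>
    lower_nilpotent m (euler_op a - (real n * real m) *\<^sub>R a)"
proof (induction m arbitrary: a)
  case 0
  then show ?case by (simp add: euler_op_def)
next
  case (Suc m)
  have "lower \<mu> (euler_op a - (real n * real (Suc m)) *\<^sub>R a) =
      euler_op (lower \<mu> a) - (real n * real m) *\<^sub>R lower \<mu> a" for \<mu>
    by (simp add: lower_euler_op[OF Suc.prems(2)] algebra_simps)
  then show ?case
    using Suc.IH[OF _ lower_homogeneous[OF Suc.prems(2)]] Suc.prems(1) by simp
qed

text \<open>Induction along the filtration: on each quotient the Laplacian is a positive scalar, so
  subtracting that scalar lowers the level, and finitely many such factors reach 0.\<close>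

lemma homogeneous_annihilated:
  fixes a :: "'d::finite local_form"
  assumes "a \<in> homogeneous n p" and "n > 0" and "p < CARD('d)"
  shows "a \<in> annihilated laplacian"
proof -
  have "a \<in> annihilated laplacian" if "lower_nilpotent m a" "a \<in> homogeneous n p"
    for m and a :: "'d local_form"
    using that
  proof (induction m arbitrary: a)
    case 0
    then show ?case by (simp add: subspace_0[OF subspace_annihilated[OF linear_laplacian]])
  next
    case (Suc m)
    \<comment> \<open>The eigenvalue on the top quotient: \<open>laplacian_homogeneous\<close>
      contributes the first summand and \<open>euler_op\<close> the second. Positivity uses
      \<open>n > 0\<close> and \<open>p < CARD('d)\<close>.\<close>
    define c where "c = real n * (real CARD('d) - real p) + real n * real m"
    have "c > 0"
      unfolding c_def using assms by (intro add_pos_nonneg) auto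
    let ?b = "euler_op a - (real n * real m) *\<^sub>R a"
    have b: "?b = laplacian a - c *\<^sub>R a"
      by (simp add: c_def laplacian_homogeneous[OF Suc.prems(2)] algebra_simps)
    have "?b \<in> homogeneous n p"
      by (intro subspace_diff subspace_scale subspace_homogeneous euler_op_homogeneous Suc.prems)
    then have "?b \<in> annihilated laplacian"
      using Suc.IH lower_nilpotent_euler_op[OF Suc.prems] by blast
    then obtain ls where ls: "0 \<notin> set ls" "compose_shifted laplacian ls ?b = 0"
      by (auto simp: annihilated_def)
    \<comment> \<open>The last list entry acts first, producing \<open>?b\<close>.\<close>
    have "compose_shifted laplacian (ls @ [c]) a = 0"
      using ls(2) by (simp add: b compose_shifted_append)
    moreover have "0 \<notin> set (ls @ [c])" using ls(1) \<open>c > 0\<close> by simp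
    ultimately show ?case unfolding annihilated_def by blast
  qed
  then show ?thesis using ex_lower_nilpotent assms by blast
qed


section \<open>Gradings and invariant polynomials\<close>

lemma (in twisted_derivation) deriv_eigenvector_prod:
  assumes "\<And>a. \<sigma> a = a" and "\<And>g. T (gen g) = real (w g) *\<^sub>R gen g"
  shows "T (prod_list (map gen gs)) = real (sum_list (map w gs)) *\<^sub>R prod_list (map gen gs)"
  by (induction gs) (simp_all add: assms deriv_1 deriv_mult algebra_simps)

lemma monomial_homogeneous:
  "prod_list (map gen gs) \<in> homogeneous (sum_list (map agh gs)) (sum_list (map form_deg gs))"
  by (simp add: homogeneous_def agh_op.deriv_eigenvector_prod degree_op.deriv_eigenvector_prod
      degree_op_gen)

text \<open>The two memberships may come from different expansions of \<open>a\<close>, so they must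
  be merged into a single one. A polynomial in \<open>agh_op\<close> does this: it removes the
  monomials of antighost number 0 from the form degree expansion and acts on \<open>a\<close> as a
  nonzero scalar.\<close>

lemma positive_agh_form_degree_less:
  fixes a :: "'d::finite local_form"
  assumes "a \<in> positive_agh" and "a \<in> form_degree_less m"
  shows "a \<in> span {prod_list (map gen gs) |gs. sum_list (map agh gs) > 0 \<and> sum_list (map form_deg gs) < m}"
    (is "_ \<in> span ?B")
proof -
  have eigen: "compose_shifted agh_op ls (prod_list (map gen gs)) =
      (\<Prod>l\<leftarrow>ls. real (sum_list (map agh gs)) - l) *\<^sub>R prod_list (map gen gs)" for ls gs
    by (intro compose_shifted_eigenvector agh_op.linear_deriv agh_op.deriv_eigenvector_prod) simp_all
  have "positive_agh \<subseteq> annihilated agh_op"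
    unfolding positive_agh_def graded_part_def
  proof (intro span_minimal subspace_annihilated agh_op.linear_deriv subsetI)
    fix x assume "x \<in> {prod_list (map gen gs) |gs. 0 < sum_list (map agh gs)}"
    then obtain gs where "x = prod_list (map gen gs)" "0 < sum_list (map agh gs)" by blast
    then have "0 \<notin> set [real (sum_list (map agh gs))]"
      and "compose_shifted agh_op [real (sum_list (map agh gs))] x = 0"
      using agh_op.deriv_eigenvector_prod[of agh gs] by (simp_all del: sum_list_eq_0_iff)
    then show "x \<in> annihilated agh_op" unfolding annihilated_def by blast
  qed
  then obtain ls where ls: "0 \<notin> set ls" "compose_shifted agh_op ls a = 0"
    using assms(1) by (auto simp: annihilated_def)
  \<comment> \<open>The value at eigenvalue 0 of the polynomial that kills \<open>a\<close>.\<close>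
  define q where "q = (\<Prod>l\<leftarrow>ls. 0 - l)"
  have "q \<noteq> 0" unfolding q_def using ls(1) by (induction ls) auto
  \<comment> \<open>\<open>Q\<close> vanishes on monomials of antighost number 0, rescales all
    others, and sends \<open>a\<close> to \<open>q *\<^sub>R a\<close>.\<close>
  define Q where "Q = (\<lambda>x :: 'd local_form. q *\<^sub>R x - compose_shifted agh_op ls x)"
  have linQ: "linear Q"
    unfolding Q_def
    by (intro linear_compose_sub linear_scale_self linear_compose_shifted agh_op.linear_deriv)
  have "Q x \<in> span ?B" if "x \<in> form_degree_less m" for x
    using that unfolding form_degree_less_def graded_part_def
  proof (induction rule: span_induct_alt)
    case base
    then show ?case using linear_0[OF linQ] by (simp add: span_zero)
  next
    case (step r x y)
    then obtain gs where x: "x = prod_list (map gen gs)" "sum_list (map form_deg gs) < m" by blast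
    have "Q x \<in> span ?B"
    proof (cases "sum_list (map agh gs) = 0")
      case True
      then have "Q x = 0"
        unfolding Q_def x eigen True q_def by simp
      then show ?thesis by (simp add: span_zero)
    next
      case False
      then have "x \<in> span ?B" using x by (blast intro: span_base)
      then show ?thesis
        unfolding Q_def x(1) eigen by (intro span_diff span_scale)
    qed
    then show ?case
      using step by (simp add: linear_add[OF linQ] linear_cmul[OF linQ] span_add span_scale)
  qed
  then have "q *\<^sub>R a \<in> span ?B"
    using assms(2) ls(2) by (force simp: Q_def)
  then have "inverse q *\<^sub>R q *\<^sub>R a \<in> span ?B" by (rule span_scale)
  then show ?thesis using \<open>q \<noteq> 0\<close> by simp
qed

section \<open>Derivations preserving polynomial subalgebras and gradings\<close>

lemma polynomials_in_base: "x \<in> X \<Longrightarrow> x \<in> polynomials_in X"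
  unfolding polynomials_in_def by (rule span_base) (auto intro!: exI[of _ "[x]"])

lemma polynomials_in_1: "1 \<in> polynomials_in X"
  unfolding polynomials_in_def by (rule span_base) (auto intro!: exI[of _ "[]"])

lemma subspace_polynomials_in: "subspace (polynomials_in X)"
  unfolding polynomials_in_def by (rule subspace_span)

lemma subspace_mult_span:
  fixes a b :: "'a::real_algebra"
  assumes V: "subspace V" and base: "\<And>x y. x \<in> A \<Longrightarrow> y \<in> B \<Longrightarrow> x * y \<in> V"
    and "a \<in> span A" "b \<in> span B"
  shows "a * b \<in> V"
proof -
  have right: "x * b \<in> V" if "x \<in> A" for x
    using \<open>b \<in> span B\<close>
  proof (induction rule: span_induct_alt)
    case (step r y z)
    then show ?case
      using V base[OF that] by (simp add: ring_distribs subspace_add subspace_scale)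
  qed (simp add: subspace_0[OF V])
  show ?thesis
    using \<open>a \<in> span A\<close>
  proof (induction rule: span_induct_alt)
    case (step r y z)
    then show ?case
      using V right by (simp add: ring_distribs subspace_add subspace_scale)
  qed (simp add: subspace_0[OF V])
qed

lemma polynomials_in_mult:
  assumes "a \<in> polynomials_in X" and "b \<in> polynomials_in X"
  shows "a * b \<in> polynomials_in X"
  using subspace_polynomials_in _ assms[unfolded polynomials_in_def]
proof (rule subspace_mult_span)
  fix x y :: "'a local_form"
  assume "x \<in> {prod_list xs |xs. set xs \<subseteq> X}" and "y \<in> {prod_list xs |xs. set xs \<subseteq> X}"
  then obtain xs ys where "x = prod_list xs" "set xs \<subseteq> X" "y = prod_list ys" "set ys \<subseteq> X"
    by blast
  then have "x * y = prod_list (xs @ ys)" "set (xs @ ys) \<subseteq> X" by simp_all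
  then show "x * y \<in> polynomials_in X"
    unfolding polynomials_in_def by (blast intro: span_base)
qed

text \<open>Stability need only be checked on generators; the twist enters because the Leibniz rule
  leaves twisted generators as prefactors.\<close>

lemma (in twisted_derivation) deriv_polynomials_in:
  assumes T: "\<And>x. x \<in> X \<Longrightarrow> T x \<in> polynomials_in X"
    and \<sigma>: "\<And>x. x \<in> X \<Longrightarrow> \<sigma> x \<in> polynomials_in X"
    and "a \<in> polynomials_in X"
  shows "T a \<in> polynomials_in X"
  using assms(3) unfolding polynomials_in_def[of X]
proof (induction rule: span_induct_alt)
  case base
  then show ?case by (simp add: deriv_0 span_zero)
next
  case (step r x y)
  from step.hyps obtain xs where x: "x = prod_list xs" "set xs \<subseteq> X" by blast
  have "T (prod_list xs) \<in> polynomials_in X" using x(2)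
  proof (induction xs)
    case Nil
    then show ?case by (simp add: deriv_1 subspace_0[OF subspace_polynomials_in])
  next
    case (Cons u us)
    then have "prod_list us \<in> polynomials_in X"
      unfolding polynomials_in_def by (auto intro: span_base)
    then show ?case
      using Cons T \<sigma>
      by (simp add: deriv_mult subspace_add[OF subspace_polynomials_in] polynomials_in_mult
          polynomials_in_base)
  qed
  then show ?case
    using step x by (simp add: deriv_add deriv_scaleR polynomials_in_def span_add span_scale)
qed

lemma graded_part_mult:
  assumes "a \<in> graded_part w (\<lambda>k. k = m)" and "b \<in> graded_part w (\<lambda>k. k = n)"
  shows "a * b \<in> graded_part w (\<lambda>k. k = m + n)"
  using _ _ assms[unfolded graded_part_def]
proof (rule subspace_mult_span)
  fix x y :: "'a local_form"
  assume "x \<in> {prod_list (map gen gs) |gs. sum_list (map w gs) = m}"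
    and "y \<in> {prod_list (map gen gs) |gs. sum_list (map w gs) = n}"
  then obtain gs hs where "x = prod_list (map gen gs)" "sum_list (map w gs) = m"
      "y = prod_list (map gen hs)" "sum_list (map w hs) = n"
    by blast
  then have "x * y = prod_list (map gen (gs @ hs))" "sum_list (map w (gs @ hs)) = m + n" by simp_all
  then show "x * y \<in> graded_part w (\<lambda>k. k = m + n)"
    unfolding graded_part_def by (blast intro: span_base)
qed (simp add: graded_part_def)

lemma graded_part_monomial:
  "P (sum_list (map w gs)) \<Longrightarrow> prod_list (map gen gs) \<in> graded_part w P"
  unfolding graded_part_def by (auto intro: span_base)

lemma graded_part_gen: "P (w g) \<Longrightarrow> gen g \<in> graded_part w P"
  using graded_part_monomial[of P w "[g]"] by simp

lemma graded_part_mono: "(\<And>k. P k \<Longrightarrow> Q k) \<Longrightarrow> graded_part w P \<subseteq> graded_part w Q"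
  unfolding graded_part_def by (intro span_mono) blast

lemma subspace_graded_part: "subspace (graded_part w P)"
  unfolding graded_part_def by (rule subspace_span)

text \<open>Preserving the exact weight of each generator preserves that of each monomial, hence any
  selection \<open>P\<close> of weights.\<close>

lemma (in twisted_derivation) deriv_graded_part:
  assumes T: "\<And>g. T (gen g) \<in> graded_part w (\<lambda>k. k = w g)"
    and \<sigma>: "\<And>g. \<sigma> (gen g) \<in> graded_part w (\<lambda>k. k = w g)"
    and "a \<in> graded_part w P"
  shows "T a \<in> graded_part w P"
  using assms(3) unfolding graded_part_def[of w P]
proof (induction rule: span_induct_alt)
  case base
  then show ?case by (simp add: deriv_0 span_zero)
next
  case (step r x y)
  from step.hyps obtain gs where x: "x = prod_list (map gen gs)" "P (sum_list (map w gs))" by blast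
  have "T (prod_list (map gen gs)) \<in> graded_part w (\<lambda>k. k = sum_list (map w gs))"
  proof (induction gs)
    case Nil
    then show ?case by (simp add: deriv_1 subspace_0[OF subspace_graded_part])
  next
    case (Cons g gs)
    then show ?case
      using graded_part_mult[OF T Cons] graded_part_mult[OF \<sigma> Cons]
        graded_part_mult[OF T graded_part_monomial[of "\<lambda>k. k = sum_list (map w gs)", OF HOL.refl]]
      by (simp add: deriv_mult subspace_add[OF subspace_graded_part])
  qed
  then have "T x \<in> graded_part w P"
    using graded_part_mono[of "\<lambda>k. k = sum_list (map w gs)" P w] x by auto
  then show ?case
    using step by (simp add: deriv_add deriv_scaleR graded_part_def span_add span_scale)
qed

section \<open>Operators on invariant polynomials\<close>

lemma curvature_deriv_induct:
  assumes add: "\<And>a b. P a \<Longrightarrow> P b \<Longrightarrow> P (a + b)" and deriv: "\<And>\<rho> a. P a \<Longrightarrow> P (\<partial> \<rho> a)"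
    and field: "\<And>c. P (jet Field {#} c)"
  shows "P (foldr \<partial> \<rho>s (curvature \<mu> \<nu> \<kappa> \<alpha> \<beta> \<delta>))"
  by (induction \<rho>s) (simp_all only: foldr.simps id_apply o_apply curvature_def Let_def add deriv field)

lemma lower_curvature: "lower \<tau> (foldr \<partial> \<rho>s (curvature \<mu> \<nu> \<kappa> \<alpha> \<beta> \<delta>)) = 0"
proof -
  let ?F = "foldr \<partial> \<rho>s (curvature \<mu> \<nu> \<kappa> \<alpha> \<beta> \<delta>)"
  \<comment> \<open>Both claims go through the induction together, since commuting
    \<open>lower\<close> past a total derivative creates an \<open>agh_op\<close> term.\<close>
  have "lower \<tau> ?F = 0 \<and> agh_op ?F = 0"
    by (rule curvature_deriv_induct[where P = "\<lambda>a. lower \<tau> a = 0 \<and> agh_op a = 0"])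
      (simp_all add: lower_total_deriv agh_op_total_deriv)
  then show ?thesis ..
qed

lemma contract_curvature: "contract \<tau> (foldr \<partial> \<rho>s (curvature \<mu> \<nu> \<kappa> \<alpha> \<beta> \<delta>)) = 0"
  by (rule curvature_deriv_induct) (simp_all add: contract_total_deriv)

lemma grade_inv_curvature:
  "grade_inv (foldr \<partial> \<rho>s (curvature \<mu> \<nu> \<kappa> \<alpha> \<beta> \<delta>)) = foldr \<partial> \<rho>s (curvature \<mu> \<nu> \<kappa> \<alpha> \<beta> \<delta>)"
  unfolding curvature_def Let_def
  by (induction \<rho>s) (simp_all add: grade_inv_total_deriv)

lemma invariant_generators_cases:
  assumes "x \<in> invariant_generators"
  obtains M c where "x = jet Antifield M c"
  | \<rho>s \<mu> \<nu> \<kappa> \<alpha> \<beta> \<delta> where "x = foldr \<partial> \<rho>s (curvature \<mu> \<nu> \<kappa> \<alpha> \<beta> \<delta>)"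
  | \<mu> where "x = dx \<mu>"
  using assms unfolding invariant_generators_def by blast

lemma invariant_jet: "jet Antifield M c \<in> invariant_polynomials"
  and invariant_curvature: "foldr \<partial> \<rho>s (curvature \<mu> \<nu> \<kappa> \<alpha> \<beta> \<delta>) \<in> invariant_polynomials"
  and invariant_dx: "dx \<mu> \<in> invariant_polynomials"
  unfolding invariant_polynomials_def invariant_generators_def
  by (rule polynomials_in_base; blast)+

lemma subspace_invariant: "subspace invariant_polynomials"
  unfolding invariant_polynomials_def by (rule subspace_polynomials_in)

lemma total_deriv_invariant: "a \<in> invariant_polynomials \<Longrightarrow> \<partial> \<rho> a \<in> invariant_polynomials"
  unfolding invariant_polynomials_def
proof (rule total_deriv.deriv_polynomials_in)
  fix x :: "'a local_form" assume x: "x \<in> invariant_generators"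
  then show "x \<in> polynomials_in invariant_generators" by (rule polynomials_in_base)
  from x show "\<partial> \<rho> x \<in> polynomials_in invariant_generators"
    unfolding invariant_polynomials_def[symmetric]
  proof (cases rule: invariant_generators_cases)
    case (2 \<rho>s \<mu> \<nu> \<kappa> \<alpha> \<beta> \<delta>)
    then show "\<partial> \<rho> x \<in> invariant_polynomials"
      using invariant_curvature[of "\<rho> # \<rho>s"] by simp
  qed (simp_all add: invariant_jet subspace_0[OF subspace_invariant])
qed

lemma lower_invariant: "a \<in> invariant_polynomials \<Longrightarrow> lower \<mu> a \<in> invariant_polynomials"
  unfolding invariant_polynomials_def
proof (rule lower.deriv_polynomials_in)
  fix x :: "'a local_form" assume x: "x \<in> invariant_generators"
  then show "x \<in> polynomials_in invariant_generators" by (rule polynomials_in_base)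
  from x show "lower \<mu> x \<in> polynomials_in invariant_generators"
    unfolding invariant_polynomials_def[symmetric]
    by (cases rule: invariant_generators_cases)
      (simp_all add: lower_curvature invariant_jet subspace_0[OF subspace_invariant]
        subspace_scale[OF subspace_invariant])
qed

lemma contract_invariant: "a \<in> invariant_polynomials \<Longrightarrow> contract \<mu> a \<in> invariant_polynomials"
  unfolding invariant_polynomials_def
proof (rule contract.deriv_polynomials_in)
  fix x :: "'a local_form" assume x: "x \<in> invariant_generators"
  \<comment> \<open>Contracting a form generator can leave the unit, that is, the empty
    product.\<close>
  have "(1 :: 'a local_form) \<in> invariant_polynomials"
    unfolding invariant_polynomials_def by (rule polynomials_in_1)
  with x show "contract \<mu> x \<in> polynomials_in invariant_generators"
    unfolding invariant_polynomials_def[symmetric]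
    by (cases rule: invariant_generators_cases)
      (simp_all add: contract_curvature subspace_0[OF subspace_invariant])
  from x show "grade_inv x \<in> polynomials_in invariant_generators"
    unfolding invariant_polynomials_def[symmetric]
    by (cases rule: invariant_generators_cases)
      (simp_all add: grade_inv_curvature invariant_jet invariant_curvature invariant_dx
        subspace_neg[OF subspace_invariant])
qed

lemma homotopy_invariant: "a \<in> invariant_polynomials \<Longrightarrow> homotopy a \<in> invariant_polynomials"
  unfolding homotopy_def
  by (intro subspace_sum subspace_invariant contract_invariant lower_invariant)

lemma ext_d_invariant:
  assumes "a \<in> invariant_polynomials"
  shows "ext_d a \<in> invariant_polynomials"
proof -
  have "dx \<mu> * \<partial> \<mu> a \<in> invariant_polynomials" for \<mu>
    using total_deriv_invariant[OF assms] invariant_dx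
    unfolding invariant_polynomials_def by (intro polynomials_in_mult)
  then show ?thesis
    unfolding ext_d_def by (intro subspace_sum subspace_invariant)
qed

section \<open>Stability of positive antighost number\<close>

lemma subspace_positive_agh: "subspace positive_agh"
  unfolding positive_agh_def by (rule subspace_graded_part)

lemma agh_graded_jet: "jet k M c \<in> graded_part agh (\<lambda>n. n = agh (Jet k {#} c))"
  using agh_jet[of k M c] by (intro graded_part_gen)

lemma total_deriv_positive_agh: "a \<in> positive_agh \<Longrightarrow> \<partial> \<rho> a \<in> positive_agh"
  unfolding positive_agh_def
proof (rule total_deriv.deriv_graded_part)
  fix g :: "'a generator"
  show "gen g \<in> graded_part agh (\<lambda>k. k = agh g)" by (simp add: graded_part_gen)
  show "\<partial> \<rho> (gen g) \<in> graded_part agh (\<lambda>k. k = agh g)"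
  proof (cases g)
    case (Jet k M c)
    then show ?thesis using agh_graded_jet[of k _ c] agh_jet[of k M c] by simp
  qed (simp add: subspace_0[OF subspace_graded_part])
qed

lemma lower_positive_agh: "a \<in> positive_agh \<Longrightarrow> lower \<mu> a \<in> positive_agh"
  unfolding positive_agh_def
proof (rule lower.deriv_graded_part)
  fix g :: "'a generator"
  show "gen g \<in> graded_part agh (\<lambda>k. k = agh g)" by (simp add: graded_part_gen)
  show "lower \<mu> (gen g) \<in> graded_part agh (\<lambda>k. k = agh g)"
  proof (cases g)
    case (Jet k M c)
    then show ?thesis
      using agh_graded_jet[of k _ c] agh_jet[of k M c]
      by (simp add: subspace_scale[OF subspace_graded_part])
  qed (simp add: subspace_0[OF subspace_graded_part])
qed

lemma contract_positive_agh: "a \<in> positive_agh \<Longrightarrow> contract \<mu> a \<in> positive_agh"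
  unfolding positive_agh_def
proof (rule contract.deriv_graded_part)
  fix g :: "'a generator"
  have g: "gen g \<in> graded_part agh (\<lambda>k. k = agh g)" by (simp add: graded_part_gen)
  show "grade_inv (gen g) \<in> graded_part agh (\<lambda>k. k = agh g)"
    using g subspace_neg[OF subspace_graded_part g] by simp
  show "contract \<mu> (gen g) \<in> graded_part agh (\<lambda>k. k = agh g)"
    using graded_part_monomial[of "\<lambda>k. k = 0" agh "[] :: 'a generator list"]
    by (cases g) (simp_all add: subspace_0[OF subspace_graded_part])
qed

lemma homotopy_positive_agh: "a \<in> positive_agh \<Longrightarrow> homotopy a \<in> positive_agh"
  unfolding homotopy_def
  by (intro subspace_sum subspace_positive_agh contract_positive_agh lower_positive_agh)

lemma dx_mult_positive_agh:
  assumes "a \<in> positive_agh"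
  shows "dx \<mu> * a \<in> positive_agh"
  using subspace_positive_agh _ span_base[of "dx \<mu>" "{dx \<mu>}", OF singletonI]
    assms[unfolded positive_agh_def graded_part_def]
proof (rule subspace_mult_span)
  fix x y :: "'a local_form"
  assume "x \<in> {dx \<mu>}" and "y \<in> {prod_list (map gen gs) |gs. sum_list (map agh gs) > 0}"
  then obtain gs where "x * y = prod_list (map gen (Dx \<mu> # gs))"
      and "sum_list (map agh (Dx \<mu> # gs)) > 0"
    by auto
  then show "x * y \<in> positive_agh"
    unfolding positive_agh_def by (metis graded_part_monomial[of "\<lambda>k. k > 0"])
qed

lemma ext_d_positive_agh: "a \<in> positive_agh \<Longrightarrow> ext_d a \<in> positive_agh"
  unfolding ext_d_def
  by (intro subspace_sum subspace_positive_agh dx_mult_positive_agh total_deriv_positive_agh)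

theorem theorem3p1:
  fixes \<alpha> :: "'d::finite local_form"
  assumes "CARD('d) \<ge> 5"
    and "\<alpha> \<in> invariant_polynomials"
    and "\<gamma> \<alpha> = 0"
    and "ext_d \<alpha> = 0"
    and "\<alpha> \<in> positive_agh"
    and "\<alpha> \<in> form_degree_less CARD('d)"
  shows "\<exists>\<beta> \<in> invariant_polynomials. \<beta> \<in> positive_agh \<and> \<alpha> = ext_d \<beta>"
proof -
  \<comment> \<open>Monomials may contain bare fields and need not be invariant. Only annihilation
    is checked on them; the primitive is built from \<open>\<alpha>\<close> itself.\<close>
  have "span {prod_list (map gen gs) |gs. sum_list (map agh gs) > 0 \<and>
      sum_list (map form_deg gs) < CARD('d)} \<subseteq> (annihilated laplacian :: 'd local_form set)"
  proof (intro span_minimal subspace_annihilated linear_laplacian subsetI)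
    fix x :: "'d local_form"
    assume "x \<in> {prod_list (map gen gs) |gs. sum_list (map agh gs) > 0 \<and>
      sum_list (map form_deg gs) < CARD('d)}"
    then show "x \<in> annihilated laplacian"
      using homogeneous_annihilated[OF monomial_homogeneous] by blast
  qed
  then have "\<alpha> \<in> annihilated laplacian"
    using positive_agh_form_degree_less assms by blast
  \<comment> \<open>Running the homotopy argument inside the intersection puts the primitive in both
    subspaces at once.\<close>
  then have "\<exists>\<beta>\<in>invariant_polynomials \<inter> positive_agh. \<alpha> = ext_d \<beta>"
    using assms unfolding laplacian_def
    by (intro exact_of_annihilated[where h = homotopy] linear_ext_d linear_homotopy
        subspace_inter subspace_invariant subspace_positive_agh)
      (auto simp: ext_d_ext_d ext_d_invariant ext_d_positive_agh homotopy_invariant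
        homotopy_positive_agh)
  then show ?thesis by blast
qed

end
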